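(* Let $n>2$ be an even integer and let $G$ be a group of order $2n$. Suppose that $G$ is one of the following: a dihedral group; a dicyclic group; an abelian group admitting a cyclic subgroup of index $2$ that is not a cyclic $2$-group; a non-cyclic $2$-group admitting a cyclic subgroup of index $2$. Then there exists a $G$-regular $1$-factorization of the complete graph $K_{2n}$ together with a complete set of rainbow spanning trees.
   Context: Identify the vertex set of $K_{2n}$ with the elements of $G$, with $G$ acting on vertices by right multiplication ($x\mapsto xg$), hence on edges by $[x,y]\cdot g=[xg,yg]$. A $1$-factorization of $K_{2n}$ is a partition of its edge set into $2n-1$ perfect matchings ($1$-factors). It is $G$-regular if $G$, acting in this way (sharply transitively on vertices), maps every $1$-factor of the factorization to a $1$-factor of the factorization. A rainbow spanning tree (with respect to the $1$-factorization) is a spanning tree of $K_{2n}$ having exactly one edge in each $1$-factor. A complete set of rainbow spanning trees is a set of rainbow spanning trees that partitions the edge set of $K_{2n}$ (so it consists of $n$ trees). A dicyclic group of order $4s$, $s\ge2$, is $\langle a,b: a^{2s}=1,\ b^2=a^s,\ b^{-1}ab=a^{-1}\rangle$. *)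

theory Defs
  imports "HOL-Algebra.Algebra"
begin

section \<open>Group-theoretic notions\<close>

definition cyclic_grp :: "('a, 'b) monoid_scheme \<Rightarrow> bool" where
  "cyclic_grp G \<longleftrightarrow> (\<exists>x \<in> carrier G. carrier G = generate G {x})"

definition cyclic_subgroup :: "'a set \<Rightarrow> ('a, 'b) monoid_scheme \<Rightarrow> bool" where
  "cyclic_subgroup H G \<longleftrightarrow> subgroup H G \<and> (\<exists>x \<in> H. H = generate G {x})"

definition has_cyclic_subgroup_index2 :: "('a, 'b) monoid_scheme \<Rightarrow> bool" where
  "has_cyclic_subgroup_index2 G \<longleftrightarrow>
     (\<exists>H. cyclic_subgroup H G \<and> 2 * card H = order G)"

definition two_group :: "('a, 'b) monoid_scheme \<Rightarrow> bool" where
  "two_group G \<longleftrightarrow> finite (carrier G) \<and> (\<exists>k::nat. order G = 2 ^ k)"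

text \<open>Dihedral group of order 2m (given by its standard presentation
  \<open>\<langle>a,b : a^m = 1, b^2 = 1, b^-1 a b = a^-1\<rangle>\<close>; a finite group of order 2m
  generated by elements satisfying these relations is isomorphic to the
  dihedral group of order 2m, since the presented group has order 2m).\<close>
definition dihedral_grp :: "('a, 'b) monoid_scheme \<Rightarrow> bool" where
  "dihedral_grp G \<longleftrightarrow> finite (carrier G) \<and> even (order G) \<and>
     (\<exists>a \<in> carrier G. \<exists>b \<in> carrier G.
        carrier G = generate G {a, b} \<and>
        a [^]\<^bsub>G\<^esub> (order G div 2) = \<one>\<^bsub>G\<^esub> \<and>
        b [^]\<^bsub>G\<^esub> (2::nat) = \<one>\<^bsub>G\<^esub> \<and>
        inv\<^bsub>G\<^esub> b \<otimes>\<^bsub>G\<^esub> a \<otimes>\<^bsub>G\<^esub> b = inv\<^bsub>G\<^esub> a)"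

text \<open>Dicyclic group of order 4s, s \<ge> 2:
  \<open>\<langle>a,b : a^(2s) = 1, b^2 = a^s, b^-1 a b = a^-1\<rangle>\<close> (the presented group has
  order 4s, so a group of order 4s generated by such elements is dicyclic).\<close>
definition dicyclic_grp :: "('a, 'b) monoid_scheme \<Rightarrow> bool" where
  "dicyclic_grp G \<longleftrightarrow> finite (carrier G) \<and>
     (\<exists>s::nat. s \<ge> 2 \<and> order G = 4 * s \<and>
       (\<exists>a \<in> carrier G. \<exists>b \<in> carrier G.
          carrier G = generate G {a, b} \<and>
          a [^]\<^bsub>G\<^esub> (2 * s) = \<one>\<^bsub>G\<^esub> \<and>
          b [^]\<^bsub>G\<^esub> (2::nat) = a [^]\<^bsub>G\<^esub> s \<and>
          inv\<^bsub>G\<^esub> b \<otimes>\<^bsub>G\<^esub> a \<otimes>\<^bsub>G\<^esub> b = inv\<^bsub>G\<^esub> a))"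

section \<open>The complete graph on a vertex set, factorizations, rainbow trees\<close>

text \<open>Edges of the complete graph K_V: the 2-element subsets of V.\<close>
definition complete_edges :: "'a set \<Rightarrow> 'a set set" where
  "complete_edges V = {{x, y} | x y. x \<in> V \<and> y \<in> V \<and> x \<noteq> y}"

definition perfect_matching :: "'a set \<Rightarrow> 'a set set \<Rightarrow> bool" where
  "perfect_matching V M \<longleftrightarrow> M \<subseteq> complete_edges V \<and>
     (\<forall>v \<in> V. \<exists>!e. e \<in> M \<and> v \<in> e)"

text \<open>A 1-factorization of K_V: a partition of its edge set into perfect matchings.\<close>
definition one_factorization :: "'a set \<Rightarrow> 'a set set set \<Rightarrow> bool" where
  "one_factorization V F \<longleftrightarrow>
     (\<forall>M \<in> F. perfect_matching V M \<and> M \<noteq> {}) \<and>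
     (\<forall>M \<in> F. \<forall>M' \<in> F. M \<noteq> M' \<longrightarrow> M \<inter> M' = {}) \<and>
     \<Union> F = complete_edges V"

text \<open>Right action of g on edges and on sets of edges.\<close>
definition edge_act :: "('a, 'b) monoid_scheme \<Rightarrow> 'a set \<Rightarrow> 'a \<Rightarrow> 'a set" where
  "edge_act G e g = (\<lambda>x. x \<otimes>\<^bsub>G\<^esub> g) ` e"

definition G_regular :: "('a, 'b) monoid_scheme \<Rightarrow> 'a set set set \<Rightarrow> bool" where
  "G_regular G F \<longleftrightarrow> (\<forall>M \<in> F. \<forall>g \<in> carrier G. (\<lambda>e. edge_act G e g) ` M \<in> F)"

text \<open>Graph (V, T) notions: connectivity and absence of cycles.\<close>
definition adj :: "'a set set \<Rightarrow> ('a \<times> 'a) set" where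
  "adj T = {(u, v). {u, v} \<in> T \<and> u \<noteq> v}"

definition connected_on :: "'a set \<Rightarrow> 'a set set \<Rightarrow> bool" where
  "connected_on V T \<longleftrightarrow> (\<forall>x \<in> V. \<forall>y \<in> V. (x, y) \<in> (adj T)\<^sup>*)"

text \<open>A cycle: a list of at least 3 distinct vertices, consecutive ones adjacent
  and the last adjacent to the first.\<close>
definition is_cycle :: "'a set set \<Rightarrow> 'a list \<Rightarrow> bool" where
  "is_cycle T vs \<longleftrightarrow> length vs \<ge> 3 \<and> distinct vs \<and>
     (\<forall>i < length vs - 1. {vs ! i, vs ! Suc i} \<in> T) \<and>
     {last vs, hd vs} \<in> T"

definition acyclic_graph :: "'a set set \<Rightarrow> bool" where
  "acyclic_graph T \<longleftrightarrow> (\<nexists>vs. is_cycle T vs)"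

definition spanning_tree :: "'a set \<Rightarrow> 'a set set \<Rightarrow> bool" where
  "spanning_tree V T \<longleftrightarrow> T \<subseteq> complete_edges V \<and> connected_on V T \<and> acyclic_graph T"

definition rainbow_spanning_tree :: "'a set \<Rightarrow> 'a set set set \<Rightarrow> 'a set set \<Rightarrow> bool" where
  "rainbow_spanning_tree V F T \<longleftrightarrow> spanning_tree V T \<and> (\<forall>M \<in> F. card (T \<inter> M) = 1)"

text \<open>A complete set of rainbow spanning trees: rainbow spanning trees partitioning
  the edge set of K_V.\<close>
definition complete_rainbow_set :: "'a set \<Rightarrow> 'a set set set \<Rightarrow> 'a set set set \<Rightarrow> bool" where
  "complete_rainbow_set V F S \<longleftrightarrow>
     (\<forall>T \<in> S. rainbow_spanning_tree V F T) \<and>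
     (\<forall>T \<in> S. \<forall>T' \<in> S. T \<noteq> T' \<longrightarrow> T \<inter> T' = {}) \<and>
     \<Union> S = complete_edges V"

end

theory Submission
  imports Defs
begin

text \<open>Let \<open>a\<close> generate a cyclic subgroup of index 2, of order \<open>n = 2s\<close>, and put \<open>P i = a^i\<close>,
  \<open>Q i = b a^i\<close>. In every group of the theorem \<open>b\<close> can be chosen such that either
  \<open>b^2 \<in> {1, a^s}\<close>, or \<open>G\<close> is cyclic, \<open>b^2 = a\<close> and \<open>n\<close> is divisible by \<open>4m\<close> for some odd
  \<open>m \<ge> 3\<close>. Edges inside a coset of \<open>\<langle>a\<rangle>\<close> are coloured by the sum of the two exponents and edges
  between the cosets by the difference of the exponents. The few vertices that a sum leaves unmatched,
  namely the fixed points of \<open>i \<mapsto> t - i\<close> and the ends of an edge \<open>{x, x a^s}\<close>, are matched by edges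
  from a few chosen differences.

  A tree consists of half a star at \<open>P i\<close>, half a star at \<open>Q i\<close>, one edge of each
  difference between the cosets, one edge \<open>{x, x a^s}\<close> and, in the second case, two edges
  \<open>{x, x a}\<close>. The tree moves with \<open>i\<close>, except that the
  edge \<open>{x, x a^s}\<close> lies in the first coset for \<open>i < s\<close> and in the second one for \<open>i \<ge> s\<close>, because these
  edges are fixed by \<open>a^s\<close>. Without this edge a tree is a forest with two components, and either
  choice of the edge joins them.\<close>

section \<open>Colourings and trees\<close>

lemma finite_complete_edges: "finite V \<Longrightarrow> finite (complete_edges V)"
  by (rule finite_subset[of _ "Pow V"]) (auto simp: complete_edges_def)

lemma card_complete_edges:
  assumes "finite V"
  shows "card (complete_edges V) = card V choose 2"
proof -
  have "complete_edges V = {e. e \<subseteq> V \<and> card e = 2}"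
    by (auto simp: complete_edges_def card_2_iff)
  then show ?thesis
    using n_subsets[OF assms] by simp
qed

text \<open>Taking successors modulo the length makes the closing edge of a cycle an edge like the
  others.\<close>

lemma cycle_edge:
  assumes "is_cycle T vs" "i < length vs"
  shows "{vs ! i, vs ! (Suc i mod length vs)} \<in> T"
proof (cases "Suc i = length vs")
  case True
  have "vs \<noteq> []" using assms(2) by auto
  then have "last vs = vs ! i" "hd vs = vs ! 0"
    by (simp_all add: last_conv_nth hd_conv_nth flip: True)
  with True assms(1) show ?thesis
    by (simp add: is_cycle_def)
next
  case False
  with assms show ?thesis
    by (simp add: is_cycle_def)
qed

text \<open>Each vertex other than the root has an edge to a vertex one step nearer to the root. With at
  most \<open>card V - 1\<close> edges there are no others, so a vertex of a cycle farthest from the root would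
  have only one neighbour on the cycle.\<close>

lemma acyclic_graph_if_connected_on:
  assumes V: "finite V" "V \<noteq> {}" and T: "T \<subseteq> complete_edges V"
    and conn: "connected_on V T" and card: "card T \<le> card V - 1"
  shows "acyclic_graph T"
proof -
  from V obtain r where r: "r \<in> V" by blast
  define dst where "dst v = (LEAST k. (r, v) \<in> adj T ^^ k)" for v
  have reach: "(r, v) \<in> adj T ^^ dst v" if "v \<in> V" for v
  proof -
    have "\<exists>k. (r, v) \<in> adj T ^^ k"
      using conn r that by (auto simp: connected_on_def rtrancl_power)
    then show ?thesis unfolding dst_def by (rule LeastI_ex)
  qed
  have dst_le: "dst v \<le> k" if "(r, v) \<in> adj T ^^ k" for v k
    unfolding dst_def using that by (rule Least_le)
  have "\<exists>u. {u, v} \<in> T \<and> u \<noteq> v \<and> dst v = Suc (dst u)" if v: "v \<in> V - {r}" for v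
  proof -
    have "dst v \<noteq> 0"
      using reach[of v] v by (metis Diff_iff insertI1 relpow_0_E)
    then obtain k where k: "dst v = Suc k" by (cases "dst v") auto
    with reach[of v] v obtain u where u: "(r, u) \<in> adj T ^^ k" "(u, v) \<in> adj T"
      by auto
    have uV: "u \<in> V"
      using u(2) T by (fastforce simp: adj_def complete_edges_def doubleton_eq_iff)
    have "dst v \<le> Suc (dst u)"
      using reach[OF uV] u(2) by (intro dst_le) auto
    with dst_le[OF u(1)] k have "dst v = Suc (dst u)" by simp
    with u(2) show ?thesis by (auto simp: adj_def)
  qed
  then obtain p where p: "{p v, v} \<in> T" "p v \<noteq> v" "dst v = Suc (dst (p v))" if "v \<in> V - {r}" for v
    by metis
  have inj: "inj_on (\<lambda>v. {p v, v}) (V - {r})"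
  proof (rule inj_onI)
    fix v w assume vw: "v \<in> V - {r}" "w \<in> V - {r}" "{p v, v} = {p w, w}"
    then consider "v = w" | "v = p w" "w = p v" by (auto simp: doubleton_eq_iff)
    then show "v = w" using p(3) vw by cases (metis n_not_Suc_n Suc_n_not_le_n le_SucI order_refl)+
  qed
  have "finite T" using T finite_complete_edges[OF V(1)] finite_subset by blast
  moreover have "card T \<le> card ((\<lambda>v. {p v, v}) ` (V - {r}))"
    using card card_image[OF inj] r V by simp
  moreover have "(\<lambda>v. {p v, v}) ` (V - {r}) \<subseteq> T" using p(1) by blast
  ultimately have T_eq: "T = (\<lambda>v. {p v, v}) ` (V - {r})"
    using card_seteq by blast
  have parent: "w = p v" if "{v, w} \<in> T" "dst w \<le> dst v" for v w
  proof -
    from that(1) obtain x where x: "x \<in> V - {r}" "{v, w} = {p x, x}" using T_eq by auto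
    then consider "x = v" "w = p v" | "x = w" "v = p w" by (auto simp: doubleton_eq_iff)
    then show ?thesis using p(3)[OF x(1)] that(2) by cases auto
  qed
  show ?thesis
    unfolding acyclic_graph_def
  proof
    assume "\<exists>vs. is_cycle T vs"
    then obtain vs where vs: "is_cycle T vs" ..
    define L where "L = length vs"
    have L: "L \<ge> 3" and dist: "distinct vs" using vs by (auto simp: is_cycle_def L_def)
    have "Max ((\<lambda>i. dst (vs ! i)) ` {..<L}) \<in> (\<lambda>i. dst (vs ! i)) ` {..<L}"
      using L by (intro Max_in) (auto simp: lessThan_empty_iff)
    then obtain k where k: "k < L" "dst (vs ! k) = Max ((\<lambda>i. dst (vs ! i)) ` {..<L})"
      by auto
    have mx: "dst (vs ! i) \<le> dst (vs ! k)" if "i < L" for i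
      unfolding k(2) using that by (intro Max_ge) auto
    \<comment> \<open>The cyclic predecessor of \<open>k\<close>. Both neighbours of
      \<open>vs ! k\<close> on the cycle turn out to be its parent, which is impossible for length
      at least 3.\<close>
    define j where "j = (if k = 0 then L - 1 else k - 1)"
    have j: "j < L" "Suc j mod L = k" using k(1) L by (auto simp: j_def)
    have i: "Suc k mod L < L" using L by (intro mod_less_divisor) simp
    have "{vs ! k, vs ! (Suc k mod L)} \<in> T" "{vs ! j, vs ! k} \<in> T"
      using cycle_edge[OF vs] k(1) j by (auto simp: L_def)
    then have "vs ! (Suc k mod L) = vs ! j"
      using parent mx i j(1) by (metis insert_commute)
    then have "Suc k mod L = j"
      using dist i j(1) by (simp add: nth_eq_iff_index_eq L_def)
    then show False
      using k(1) L by (cases "Suc k = L") (auto simp: j_def split: if_splits)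
  qed
qed

lemma adj_sym: "sym (adj T)"
  by (auto simp: sym_def adj_def insert_commute)

lemma connected_onI:
  assumes "\<And>v. v \<in> V \<Longrightarrow> (r, v) \<in> (adj T)\<^sup>*"
  shows "connected_on V T"
  unfolding connected_on_def
  using assms sym_rtrancl[OF adj_sym, of T] by (meson rtrancl_trans symD)

text \<open>Counting replaces uniqueness arguments: a tree that meets all \<open>2n - 1\<close> colours has just one
  edge of each, and \<open>n\<close> such trees that cover all edges are disjoint.\<close>

lemma regular_factorization_with_trees:
  fixes G (structure) and c :: "'a \<Rightarrow> 'a \<Rightarrow> 'c" and T :: "'i \<Rightarrow> 'a set set"
  assumes grp: "group G" and fin: "finite (carrier G)" and ord: "order G = 2 * n"
    and sym: "\<And>x y. x \<in> carrier G \<Longrightarrow> y \<in> carrier G \<Longrightarrow> c x y = c y x"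
    and inj: "inj_on (c \<one>) (carrier G - {\<one>})"
    and act: "\<And>g. g \<in> carrier G \<Longrightarrow>
      \<exists>\<phi>. \<forall>x\<in>carrier G. \<forall>y\<in>carrier G. x \<noteq> y \<longrightarrow> c (x \<otimes> g) (y \<otimes> g) = \<phi> (c x y)"
    and I: "finite I" "card I \<le> n"
    and T: "\<And>i. i \<in> I \<Longrightarrow> T i \<subseteq> complete_edges (carrier G)"
    and T_card: "\<And>i. i \<in> I \<Longrightarrow> card (T i) \<le> 2 * n - 1"
    and T_conn: "\<And>i. i \<in> I \<Longrightarrow> connected_on (carrier G) (T i)"
    and T_hits: "\<And>i w. i \<in> I \<Longrightarrow> w \<in> carrier G - {\<one>} \<Longrightarrow> \<exists>x y. {x, y} \<in> T i \<and> c x y = c \<one> w"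
    and cover: "complete_edges (carrier G) \<subseteq> (\<Union>i\<in>I. T i)"
  shows "\<exists>F S. one_factorization (carrier G) F \<and> G_regular G F
               \<and> complete_rainbow_set (carrier G) F S"
proof -
  interpret group G by fact
  let ?V = "carrier G"
  define C where "C = c \<one> ` (?V - {\<one>})"
  define cls where "cls \<kappa> = {{x, y} | x y. x \<in> ?V \<and> y \<in> ?V \<and> x \<noteq> y \<and> c x y = \<kappa>}" for \<kappa>
  have V: "card ?V = 2 * n" using ord by (simp add: order_def)
  have n: "n > 0" using V fin by (metis card_gt_0_iff carrier_not_empty mult_0_right neq0_conv)
  have C: "card C = 2 * n - 1"
    using card_image[OF inj] V fin by (simp add: C_def)
  have finC: "finite C" using fin by (simp add: C_def)
  have cls_iff: "{x, y} \<in> cls \<kappa> \<longleftrightarrow> c x y = \<kappa>" if "x \<in> ?V" "y \<in> ?V" "x \<noteq> y" for x y \<kappa>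
    using that sym by (auto simp: cls_def doubleton_eq_iff)
  have cls_edges: "cls \<kappa> \<subseteq> complete_edges ?V" for \<kappa>
    by (auto simp: cls_def complete_edges_def)
  have cls_disj: "\<kappa> = \<kappa>'" if "e \<in> cls \<kappa>" "e \<in> cls \<kappa>'" for e \<kappa> \<kappa>'
  proof -
    from that(1) obtain x y where "e = {x, y}" "x \<in> ?V" "y \<in> ?V" "x \<noteq> y" "c x y = \<kappa>"
      by (auto simp: cls_def)
    with that(2) cls_iff show ?thesis by blast
  qed
  \<comment> \<open>A translation moves \<open>x\<close> to \<open>\<one>\<close>, where all colours
    are distinct.\<close>
  have proper: "y = y'"
    if xy: "x \<in> ?V" "y \<in> ?V" "y' \<in> ?V" "x \<noteq> y" "x \<noteq> y'" "c x y = c x y'" for x y y'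
  proof -
    obtain \<phi> where \<phi>: "\<forall>x'\<in>?V. \<forall>y\<in>?V. x' \<noteq> y \<longrightarrow> c (x' \<otimes> inv x) (y \<otimes> inv x) = \<phi> (c x' y)"
      using act[of "inv x"] xy by auto
    have "c \<one> (y \<otimes> inv x) = c \<one> (y' \<otimes> inv x)"
      using \<phi> xy by (metis r_inv)
    moreover have "y \<otimes> inv x \<noteq> \<one>" "y' \<otimes> inv x \<noteq> \<one>"
      using xy by (metis inv_closed inv_inv inv_equality)+
    ultimately have "y \<otimes> inv x = y' \<otimes> inv x"
      using inj xy by (auto dest: inj_onD)
    then show ?thesis using xy by simp
  qed
  \<comment> \<open>One edge of each colour makes \<open>2 * n - 1\<close> edges, as many as the
    tree may have, so the choice \<open>f\<close> exhausts the tree.\<close>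
  have tree: "\<exists>f. T i = f ` C \<and> (\<forall>\<kappa>\<in>C. f \<kappa> \<in> cls \<kappa>)" if i: "i \<in> I" for i
  proof -
    have "\<exists>e. e \<in> T i \<and> e \<in> cls \<kappa>" if "\<kappa> \<in> C" for \<kappa>
    proof -
      from that obtain w where w: "w \<in> ?V - {\<one>}" "\<kappa> = c \<one> w" by (auto simp: C_def)
      from T_hits[OF i w(1)] w(2) obtain x y where xy: "{x, y} \<in> T i" "c x y = \<kappa>" by auto
      from xy(1) T[OF i] have "x \<in> ?V" "y \<in> ?V" "x \<noteq> y"
        by (auto simp: complete_edges_def doubleton_eq_iff)
      with xy cls_iff[of x y] show ?thesis by blast
    qed
    then obtain f where f: "f \<kappa> \<in> T i" "f \<kappa> \<in> cls \<kappa>" if "\<kappa> \<in> C" for \<kappa>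
      by metis
    have "inj_on f C" using f(2) cls_disj by (metis inj_onI)
    then have "card (f ` C) = 2 * n - 1" using C by (simp add: card_image)
    moreover have "finite (T i)" using T[OF i] finite_complete_edges[OF fin] finite_subset by blast
    ultimately have "f ` C = T i" using f(1) T_card[OF i] by (intro card_seteq) auto
    with f(2) show ?thesis by blast
  qed
  have in_C: "c x y \<in> C" if "x \<in> ?V" "y \<in> ?V" "x \<noteq> y" for x y
  proof -
    have "{x, y} \<in> complete_edges ?V" using that by (auto simp: complete_edges_def)
    with cover obtain i where i: "i \<in> I" "{x, y} \<in> T i" by auto
    from tree[OF i(1)] i(2) obtain \<kappa> where "\<kappa> \<in> C" "{x, y} \<in> cls \<kappa>" by auto
    with cls_iff[OF that] show ?thesis by simp
  qed
  \<comment> \<open>The \<open>2 * n - 1\<close> edges at \<open>x\<close> have distinct colours in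
    \<open>C\<close>, and \<open>C\<close> has just as many elements.\<close>
  have partner: "\<exists>y\<in>?V - {x}. c x y = \<kappa>" if "x \<in> ?V" "\<kappa> \<in> C" for x \<kappa>
  proof -
    have "inj_on (c x) (?V - {x})" using proper that by (auto simp: inj_on_def)
    then have "card (c x ` (?V - {x})) = card C" using C V that fin by (simp add: card_image)
    moreover have "c x ` (?V - {x}) \<subseteq> C" using in_C that by auto
    ultimately have "c x ` (?V - {x}) = C" using finC by (intro card_subset_eq) auto
    with that show ?thesis by (metis (no_types, lifting) imageE)
  qed
  have matching: "perfect_matching ?V (cls \<kappa>)" if \<kappa>: "\<kappa> \<in> C" for \<kappa>
    unfolding perfect_matching_def
  proof (intro conjI ballI)
    fix v assume v: "v \<in> ?V"
    obtain y where y: "y \<in> ?V" "y \<noteq> v" "c v y = \<kappa>" using partner[OF v \<kappa>] by auto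
    have "e = {v, y}" if "e \<in> cls \<kappa>" "v \<in> e" for e
    proof -
      from that(1) obtain x z where xz: "e = {x, z}" "x \<in> ?V" "z \<in> ?V" "x \<noteq> z" "c x z = \<kappa>"
        by (auto simp: cls_def)
      with that(2) consider "v = x" | "v = z" by auto
      then show ?thesis
      proof cases
        case 1 with xz y v proper[of v z y] show ?thesis by auto
      next
        case 2 with xz y v proper[of v x y] sym[of x z] show ?thesis by auto
      qed
    qed
    moreover have "{v, y} \<in> cls \<kappa>" using cls_iff y v by auto
    ultimately show "\<exists>!e. e \<in> cls \<kappa> \<and> v \<in> e" by blast
  qed (rule cls_edges)
  have factorization: "one_factorization ?V (cls ` C)"
    unfolding one_factorization_def
  proof (intro conjI ballI impI)
    fix M assume "M \<in> cls ` C"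
    then obtain \<kappa> where \<kappa>: "M = cls \<kappa>" "\<kappa> \<in> C" by blast
    with matching show "perfect_matching ?V M" by simp
    with one_closed show "M \<noteq> {}" by (auto simp: perfect_matching_def)
  next
    fix M M' assume "M \<in> cls ` C" "M' \<in> cls ` C" "M \<noteq> M'"
    then show "M \<inter> M' = {}" using cls_disj by fast
  next
    show "\<Union> (cls ` C) = complete_edges ?V"
    proof
      show "complete_edges ?V \<subseteq> \<Union> (cls ` C)"
        using in_C cls_iff by (fastforce simp: complete_edges_def)
    qed (use cls_edges in auto)
  qed
  have regular: "G_regular G (cls ` C)"
    unfolding G_regular_def
  proof (intro ballI)
    fix M g assume "M \<in> cls ` C" and g: "g \<in> ?V"
    then obtain \<kappa> where \<kappa>: "M = cls \<kappa>" "\<kappa> \<in> C" by blast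
    obtain \<phi> where \<phi>: "\<And>x y. x \<in> ?V \<Longrightarrow> y \<in> ?V \<Longrightarrow> x \<noteq> y \<Longrightarrow> c (x \<otimes> g) (y \<otimes> g) = \<phi> (c x y)"
      using act[OF g] by auto
    have neq: "x \<otimes> g \<noteq> y \<otimes> g" if "x \<in> ?V" "y \<in> ?V" "x \<noteq> y" for x y using that g by simp
    obtain w where w: "w \<in> ?V - {\<one>}" "\<kappa> = c \<one> w" using \<kappa>(2) by (auto simp: C_def)
    then have "c (\<one> \<otimes> g) (w \<otimes> g) = \<phi> \<kappa>" using \<phi>[of \<one> w] by auto
    moreover have "c (\<one> \<otimes> g) (w \<otimes> g) \<in> C"
      using w g neq[of \<one> w] by (intro in_C) auto
    ultimately have \<phi>C: "\<phi> \<kappa> \<in> C" by simp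
    have "(\<lambda>e. edge_act G e g) ` cls \<kappa> = cls (\<phi> \<kappa>)"
    proof
      show "(\<lambda>e. edge_act G e g) ` cls \<kappa> \<subseteq> cls (\<phi> \<kappa>)"
      proof
        fix e assume "e \<in> (\<lambda>e. edge_act G e g) ` cls \<kappa>"
        then obtain x y where "x \<in> ?V" "y \<in> ?V" "x \<noteq> y" "c x y = \<kappa>" "e = {x \<otimes> g, y \<otimes> g}"
          by (auto simp: cls_def edge_act_def)
        then show "e \<in> cls (\<phi> \<kappa>)" using cls_iff neq \<phi> g by auto
      qed
      \<comment> \<open>Pull one end of the edge back by \<open>g\<close> and take the edge of
        colour \<open>\<kappa>\<close> there. Its translate shares a vertex and the colour with the
        given edge, so the two agree by \<open>proper\<close>.\<close>
      show "cls (\<phi> \<kappa>) \<subseteq> (\<lambda>e. edge_act G e g) ` cls \<kappa>"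
      proof
        fix e assume "e \<in> cls (\<phi> \<kappa>)"
        then obtain x y where xy: "x \<in> ?V" "y \<in> ?V" "x \<noteq> y" "c x y = \<phi> \<kappa>" "e = {x, y}"
          by (auto simp: cls_def)
        define x' where "x' = x \<otimes> inv g"
        have x': "x' \<in> ?V" "x' \<otimes> g = x" using xy g by (auto simp: x'_def m_assoc)
        obtain y' where y': "y' \<in> ?V" "y' \<noteq> x'" "c x' y' = \<kappa>" using partner[OF x'(1) \<kappa>(2)] by auto
        have "c x (y' \<otimes> g) = c x y" using \<phi>[of x' y'] x' y' xy(4) by auto
        then have "y' \<otimes> g = y" using proper[of x "y' \<otimes> g" y] xy y' x' g neq[of x' y'] by auto
        then have "e = edge_act G {x', y'} g" using x' xy by (simp add: edge_act_def)
        moreover have "{x', y'} \<in> cls \<kappa>" using cls_iff x' y' by auto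
        ultimately show "e \<in> (\<lambda>e. edge_act G e g) ` cls \<kappa>" by blast
      qed
    qed
    with \<kappa> \<phi>C show "(\<lambda>e. edge_act G e g) ` M \<in> cls ` C" by auto
  qed
  have rainbow: "rainbow_spanning_tree ?V (cls ` C) (T i)" if i: "i \<in> I" for i
    unfolding rainbow_spanning_tree_def spanning_tree_def
  proof (intro conjI ballI)
    have "card (T i) \<le> card ?V - 1" using T_card[OF i] V by simp
    moreover have "?V \<noteq> {}" by blast
    ultimately show "acyclic_graph (T i)"
      using acyclic_graph_if_connected_on[OF fin _ T[OF i] T_conn[OF i]] by simp
    fix M assume "M \<in> cls ` C"
    then obtain \<kappa> where \<kappa>: "M = cls \<kappa>" "\<kappa> \<in> C" by blast
    obtain f where f: "T i = f ` C" "\<forall>\<kappa>\<in>C. f \<kappa> \<in> cls \<kappa>" using tree[OF i] by blast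
    have "T i \<inter> M = {f \<kappa>}" using f \<kappa> cls_disj by (auto dest: cls_disj)
    then show "card (T i \<inter> M) = 1" by simp
  qed (use T[OF i] T_conn[OF i] in auto)
  have disjoint: "T i \<inter> T j = {}" if ij: "i \<in> I" "j \<in> I" "T i \<noteq> T j" for i j
  proof (rule ccontr)
    assume "T i \<inter> T j \<noteq> {}"
    then obtain e where e: "e \<in> T i" "e \<in> T j" by auto
    have finT: "finite (T i)" using T[OF ij(1)] finite_complete_edges[OF fin] finite_subset by blast
    have "complete_edges ?V \<subseteq> (\<Union>k\<in>I - {i}. T k) \<union> (T i - {e})"
      using cover e ij by fastforce
    moreover have "finite ((\<Union>k\<in>I - {i}. T k) \<union> (T i - {e}))"
      using T finite_complete_edges[OF fin] I finT by (intro finite_UnI finite_UN_I) (auto intro: finite_subset)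
    ultimately have "card (complete_edges ?V) \<le> card ((\<Union>k\<in>I - {i}. T k) \<union> (T i - {e}))"
      by (rule card_mono[rotated])
    also have "\<dots> \<le> card (\<Union>k\<in>I - {i}. T k) + card (T i - {e})" by (rule card_Un_le)
    also have "card (\<Union>k\<in>I - {i}. T k) \<le> (\<Sum>k\<in>I - {i}. card (T k))"
      using I by (intro card_UN_le) auto
    also have "(\<Sum>k\<in>I - {i}. card (T k)) \<le> (\<Sum>k\<in>I - {i}. 2 * n - 1)"
      using T_card by (intro sum_mono) auto
    also have "card (T i - {e}) < card (T i)" using e finT by (intro card_Diff1_less) auto
    also note T_card[OF ij(1)]
    also have "(\<Sum>k\<in>I - {i}. 2 * n - 1) + (2 * n - 1) = card I * (2 * n - 1)"
      using I ij(1) by (cases "card I") (auto simp: card_Diff_singleton_if)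
    also have "\<dots> \<le> n * (2 * n - 1)" using I by simp
    finally have "card (complete_edges ?V) < n * (2 * n - 1)" by simp
    moreover have "card (complete_edges ?V) = n * (2 * n - 1)"
      using card_complete_edges[OF fin] V by (simp add: choose_two)
    ultimately show False by simp
  qed
  have "complete_rainbow_set ?V (cls ` C) (T ` I)"
    unfolding complete_rainbow_set_def
    using rainbow disjoint cover T by blast
  with factorization regular show ?thesis by blast
qed

text \<open>Both orientations and the degenerate case \<open>u = v\<close> are allowed, so walking
  along a tree edge never requires distinctness of its ends.\<close>

lemma adj_rtrancl_step:
  assumes "(r, u) \<in> (adj T)\<^sup>*" "{u, v} \<in> T \<or> {v, u} \<in> T"
  shows "(r, v) \<in> (adj T)\<^sup>*"
proof (cases "u = v")
  case False
  with assms(2) have "(u, v) \<in> adj T" by (auto simp: adj_def insert_commute)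
  with assms(1) show ?thesis by (rule rtrancl_into_rtrancl)
qed (use assms in simp)

lemmas adj_rtrancl_edge = adj_rtrancl_step[OF rtrancl_refl disjI1]

section \<open>Groups with a cyclic subgroup of index two\<close>

lemma mod_eqI: "0 \<le> y \<Longrightarrow> y < n \<Longrightarrow> x = y + k * n \<Longrightarrow> x mod n = y" for x y k n :: int
  by simp

lemma mod_affine: "(p * (x mod n) + c) mod n = (p * x + c) mod n" for p x c n :: int
  by (metis mod_add_left_eq mod_mult_right_eq)

text \<open>A presentation in which \<open>r\<close> describes conjugation by \<open>b\<close> and
  \<open>g\<close> the square of \<open>b\<close>. That \<open>a\<close> has order exactly
  \<open>n\<close> and that \<open>b\<close> is no power of \<open>a\<close> follow from
  \<open>order_G\<close> by counting.\<close>

locale cyclic_index_two = group G for G (structure) +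
  fixes a b :: 'a and n r g :: int
  assumes finite_carrier: "finite (carrier G)"
    and a_closed [simp]: "a \<in> carrier G" and b_closed [simp]: "b \<in> carrier G"
    and n_pos: "n > 0" and order_G: "order G = 2 * nat n"
    and generated: "carrier G = generate G {a, b}"
    and a_pow_n: "a [^] n = \<one>"
    and a_b: "a \<otimes> b = b \<otimes> a [^] r"
    and b_b: "b \<otimes> b = a [^] g"
begin

section \<open>Normal forms of elements and edges\<close>

definition P :: "int \<Rightarrow> 'a" where "P i = a [^] i"
definition Q :: "int \<Rightarrow> 'a" where "Q i = b \<otimes> a [^] i"

lemma P_closed [simp]: "P i \<in> carrier G" and Q_closed [simp]: "Q i \<in> carrier G"
  by (simp_all add: P_def Q_def)

lemma P_mult_a: "P i \<otimes> a = P (i + 1)"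
  by (simp add: P_def int_pow_mult int_pow_1)

lemma Q_mult_a: "Q i \<otimes> a = Q (i + 1)"
  using P_mult_a[of i] by (simp add: P_def Q_def m_assoc)

lemma P_cong: "i mod n = j mod n \<Longrightarrow> P i = P j"
proof -
  assume "i mod n = j mod n"
  then obtain k where k: "i = j + n * k" by (metis mod_eqE)
  have "P i = P j \<otimes> (a [^] n) [^] k" by (simp add: P_def k int_pow_mult int_pow_pow)
  then show ?thesis by (simp add: a_pow_n int_pow_one)
qed

lemma Q_cong: "i mod n = j mod n \<Longrightarrow> Q i = Q j"
  using P_cong[of i j] by (simp add: P_def Q_def)

lemma P_mult_b: "P i \<otimes> b = Q (r * i)"
proof -
  have nat: "P (int k) \<otimes> b = Q (r * int k)" for k
  proof (induction k)
    case (Suc k)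
    have "P (int (Suc k)) \<otimes> b = P (int k) \<otimes> (a \<otimes> b)"
      using P_mult_a[of "int k"] by (simp add: add.commute flip: m_assoc)
    also have "\<dots> = Q (r * int k) \<otimes> a [^] r"
      by (simp add: a_b Suc flip: m_assoc)
    also have "\<dots> = Q (r * int (Suc k))"
    proof -
      have "r * int (Suc k) = r * int k + r" by (simp add: algebra_simps)
      then show ?thesis by (simp only: Q_def m_assoc int_pow_mult a_closed b_closed int_pow_closed)
    qed
    finally show ?case .
  qed (simp add: P_def Q_def)
  \<comment> \<open>Exponents matter only modulo \<open>n\<close>, so negative ones reduce to the
    natural case.\<close>
  have "P i = P (i mod n)" by (rule P_cong) simp
  also have "\<dots> \<otimes> b = Q (r * (i mod n))"
    using nat[of "nat (i mod n)"] n_pos by simp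
  also have "\<dots> = Q (r * i)" by (rule Q_cong) (simp add: mod_mult_right_eq)
  finally show ?thesis .
qed

lemma Q_mult_b: "Q i \<otimes> b = P (r * i + g)"
proof -
  have "Q i \<otimes> b = b \<otimes> (P i \<otimes> b)" by (simp add: Q_def P_def m_assoc)
  also have "\<dots> = (b \<otimes> b) \<otimes> a [^] (r * i)" by (simp add: P_mult_b Q_def m_assoc)
  also have "\<dots> = P (r * i + g)" by (simp add: b_b P_def int_pow_mult add.commute)
  finally show ?thesis .
qed

text \<open>The normal forms are closed under right multiplication by \<open>a\<close> and
  \<open>b\<close>. As they are finitely many, these multiplications permute them, so the inverses
  preserve the set too.\<close>

lemma carrier_subset: "carrier G \<subseteq> P ` {0..<n} \<union> Q ` {0..<n}" (is "_ \<subseteq> ?S")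
proof -
  have P_in: "P i \<in> ?S" and Q_in: "Q i \<in> ?S" for i
    using P_cong[of i "i mod n"] Q_cong[of i "i mod n"] n_pos by auto
  have closed: "x \<otimes> a \<in> ?S \<and> x \<otimes> b \<in> ?S" if "x \<in> ?S" for x
  proof -
    from that consider i where "x = P i" | i where "x = Q i" by blast
    then show ?thesis
      using P_in Q_in by cases (simp_all only: P_mult_a Q_mult_a P_mult_b Q_mult_b simp_thms)
  qed
  have S: "?S \<subseteq> carrier G" by auto
  have closed_inv: "x \<otimes> inv y \<in> ?S" if x: "x \<in> ?S" and y: "y \<in> {a, b}" for x y
  proof -
    have yc: "y \<in> carrier G" using y by auto
    have "inj_on (\<lambda>x. x \<otimes> y) ?S" using yc S by (auto simp: inj_on_def)
    moreover have "(\<lambda>x. x \<otimes> y) ` ?S \<subseteq> ?S" using closed y by blast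
    ultimately have "(\<lambda>x. x \<otimes> y) ` ?S = ?S" by (intro endo_inj_surj) auto
    with x obtain z where z: "z \<in> ?S" "x = z \<otimes> y" by blast
    with S yc have "x \<otimes> inv y = z" by (auto simp: m_assoc)
    with z show ?thesis by simp
  qed
  have "\<forall>x\<in>?S. x \<otimes> h \<in> ?S" if "h \<in> generate G {a, b}" for h
    using that
  proof (induction rule: generate.induct)
    case one
    show ?case using S by auto
  next
    case (incl h)
    then show ?case using closed by blast
  next
    case (inv h)
    then show ?case using closed_inv by blast
  next
    case (eng h1 h2)
    have "h1 \<in> carrier G" "h2 \<in> carrier G" using eng(1,2) generated by auto
    then have "x \<otimes> (h1 \<otimes> h2) = x \<otimes> h1 \<otimes> h2" if "x \<in> ?S" for x
      using that S m_assoc by auto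
    with eng(3,4) show ?case by simp
  qed
  moreover have "\<one> \<in> ?S" using P_in[of 0] by (simp add: P_def)
  ultimately show ?thesis
    using generated by (metis l_one subsetI)
qed

text \<open>Two families of at most \<open>n\<close> elements each cover a group of order
  \<open>2 * n\<close>, so no two normal forms coincide.\<close>

lemma
  shows inj_on_P: "inj_on P {0..<n}" and inj_on_Q: "inj_on Q {0..<n}"
    and P_neq_Q [simp]: "P i \<noteq> Q j"
proof -
  let ?A = "P ` {0..<n}" and ?B = "Q ` {0..<n}"
  have "card (?A \<union> ?B) \<ge> 2 * nat n"
    using card_mono[OF _ carrier_subset] order_G by (simp add: order_def)
  moreover have "card ?A \<le> nat n" "card ?B \<le> nat n"
    using card_image_le[of "{0..<n}" P] card_image_le[of "{0..<n}" Q] by auto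
  moreover have "card (?A \<union> ?B) + card (?A \<inter> ?B) = card ?A + card ?B"
    by (rule card_Un_Int[symmetric]) auto
  ultimately have c: "card ?A = nat n" "card ?B = nat n" "card (?A \<inter> ?B) = 0" by linarith+
  then show "inj_on P {0..<n}" "inj_on Q {0..<n}" by (auto intro: eq_card_imp_inj_on)
  have "?A \<inter> ?B = {}" using c(3) by simp
  moreover have "P (i mod n) \<in> ?A" "Q (j mod n) \<in> ?B" using n_pos by auto
  moreover have "P i = P (i mod n)" "Q j = Q (j mod n)"
    by (auto intro: P_cong Q_cong)
  ultimately show "P i \<noteq> Q j" by (metis disjoint_iff)
qed

lemma Q_neq_P [simp]: "Q j \<noteq> P i"
  using P_neq_Q by metis

lemma P_eq_iff: "P i = P j \<longleftrightarrow> i mod n = j mod n"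
proof
  assume "P i = P j"
  then have "P (i mod n) = P (j mod n)" using P_cong[of "i mod n" i] P_cong[of "j mod n" j] by simp
  then show "i mod n = j mod n" using inj_on_P n_pos by (auto dest: inj_onD)
qed (rule P_cong)

lemma Q_eq_iff: "Q i = Q j \<longleftrightarrow> i mod n = j mod n"
proof
  assume "Q i = Q j"
  then have "Q (i mod n) = Q (j mod n)" using Q_cong[of "i mod n" i] Q_cong[of "j mod n" j] by simp
  then show "i mod n = j mod n" using inj_on_Q n_pos by (auto dest: inj_onD)
qed (rule Q_cong)

text \<open>The free base point \<open>i\<close> allows exponents to be measured from the index of a
  tree.\<close>

lemma carrier_cases:
  assumes "v \<in> carrier G"
  obtains u where "0 \<le> u" "u < n" "v = P (i + u)" | u where "0 \<le> u" "u < n" "v = Q (i + u)"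
proof -
  from assms carrier_subset consider j where "v = P j" | j where "v = Q j" by auto
  then show ?thesis
  proof cases
    case (1 j)
    have "v = P (i + (j - i) mod n)" unfolding 1 by (rule P_cong) (simp add: mod_simps)
    then show ?thesis using that(1)[of "(j - i) mod n"] n_pos by simp
  next
    case (2 j)
    have "v = Q (i + (j - i) mod n)" unfolding 2 by (rule Q_cong) (simp add: mod_simps)
    then show ?thesis using that(2)[of "(j - i) mod n"] n_pos by simp
  qed
qed

text \<open>Two exponents cut the cycle of length \<open>n\<close> into two arcs; starting from the
  suitable end, an edge inside a coset spans the shorter one.\<close>

lemma edge_cases:
  assumes "e \<in> complete_edges (carrier G)"
  obtains i u where "0 < u" "2 * u \<le> n" "e = {P i, P (i + u)}"
    | i u where "0 < u" "2 * u \<le> n" "e = {Q i, Q (i + u)}"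
    | i j where "e = {P i, Q j}"
proof -
  have short: "\<exists>i u. 0 < u \<and> 2 * u \<le> n \<and> {f j, f (j + u')} = {f i, f (i + u)}"
    if f: "\<And>x. f (x + n) = f x" and u': "0 < u'" "u' < n" for f :: "int \<Rightarrow> 'a" and j u'
  proof (cases "2 * u' \<le> n")
    case True
    with u' show ?thesis by blast
  next
    case False
    have "{f j, f (j + u')} = {f (j + u'), f (j + u' + (n - u'))}"
      using f[of j] by (auto simp: insert_commute)
    with u' False show ?thesis by (intro exI[of _ "j + u'"] exI[of _ "n - u'"]) simp
  qed
  from assms obtain v w where vw: "e = {v, w}" "v \<in> carrier G" "w \<in> carrier G" "v \<noteq> w"
    by (auto simp: complete_edges_def)
  consider i where "v = P i" | i where "v = Q i"
    using carrier_cases[OF vw(2), of 0] by (metis add_0)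
  then show ?thesis
  proof cases
    case i: (1 i)
    show ?thesis using carrier_cases[OF vw(3), of i]
    proof cases
      case (1 u)
      with vw i have "u \<noteq> 0" by auto
      with 1 vw i short[of P u i] P_cong[of "_ + n"] that(1) show ?thesis by auto
    next
      case (2 u)
      with vw i that(3) show ?thesis by auto
    qed
  next
    case i: (2 i)
    show ?thesis using carrier_cases[OF vw(3), of i]
    proof cases
      case (1 u)
      with vw i that(3)[of "i + u" i] show ?thesis by (auto simp: insert_commute)
    next
      case (2 u)
      with vw i have "u \<noteq> 0" by auto
      with 2 vw i short[of Q u i] Q_cong[of "_ + n"] that(2) show ?thesis by auto
    qed
  qed
qed

lemma P_edge: "i mod n \<noteq> j mod n \<Longrightarrow> {P i, P j} \<in> complete_edges (carrier G)"
  unfolding complete_edges_def using P_closed P_eq_iff by blast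

lemma Q_edge: "i mod n \<noteq> j mod n \<Longrightarrow> {Q i, Q j} \<in> complete_edges (carrier G)"
  unfolding complete_edges_def using Q_closed Q_eq_iff by blast

lemma PQ_edge: "{P i, Q j} \<in> complete_edges (carrier G)"
  unfolding complete_edges_def using P_closed Q_closed P_neq_Q by blast

section \<open>Colourings described by exponents\<close>

definition idx :: "'a \<Rightarrow> int" where
  "idx v = (THE i. 0 \<le> i \<and> i < n \<and> (v = P i \<or> v = Q i))"

lemma idx_P [simp]: "idx (P i) = i mod n" and idx_Q [simp]: "idx (Q i) = i mod n"
  unfolding idx_def using n_pos by (auto simp: P_eq_iff Q_eq_iff)

text \<open>The group is transitive on the vertices, so properness of the colouring is only needed at
  \<open>P 0 = \<one>\<close>.\<close>

lemma factorization_from_indices: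
  fixes xx yy xy :: "int \<Rightarrow> int \<Rightarrow> 'c" and T :: "int \<Rightarrow> 'a set set"
  assumes period: "\<And>i j. xx (i mod n) (j mod n) = xx i j"
      "\<And>i j. yy (i mod n) (j mod n) = yy i j" "\<And>i j. xy (i mod n) (j mod n) = xy i j"
    and sym: "\<And>i j. xx i j = xx j i" "\<And>i j. yy i j = yy j i"
    and inj: "\<And>i j. i \<in> {1..<n} \<Longrightarrow> j \<in> {1..<n} \<Longrightarrow> xx 0 i = xx 0 j \<Longrightarrow> i = j"
      "\<And>i j. i \<in> {0..<n} \<Longrightarrow> j \<in> {0..<n} \<Longrightarrow> xy 0 i = xy 0 j \<Longrightarrow> i = j"
      "\<And>i j. i \<in> {1..<n} \<Longrightarrow> j \<in> {0..<n} \<Longrightarrow> xx 0 i \<noteq> xy 0 j"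
    and act_a: "\<And>i j. i mod n \<noteq> j mod n \<Longrightarrow> xx (i + 1) (j + 1) = \<phi> (xx i j)"
      "\<And>i j. i mod n \<noteq> j mod n \<Longrightarrow> yy (i + 1) (j + 1) = \<phi> (yy i j)"
      "\<And>i j. xy (i + 1) (j + 1) = \<phi> (xy i j)"
    and act_b: "\<And>i j. i mod n \<noteq> j mod n \<Longrightarrow> yy (r * i) (r * j) = \<psi> (xx i j)"
      "\<And>i j. i mod n \<noteq> j mod n \<Longrightarrow> xx (r * i + g) (r * j + g) = \<psi> (yy i j)"
      "\<And>i j. xy (r * j + g) (r * i) = \<psi> (xy i j)"
    and T: "\<And>i. T i \<subseteq> complete_edges (carrier G)" "\<And>i. card (T i) \<le> 2 * nat n - 1"
    and conn: "\<And>i u. 0 \<le> u \<Longrightarrow> u < n \<Longrightarrow> (P i, P (i + u)) \<in> (adj (T i))\<^sup>*"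
      "\<And>i u. 0 \<le> u \<Longrightarrow> u < n \<Longrightarrow> (P i, Q (i + u)) \<in> (adj (T i))\<^sup>*"
    and hits: "\<And>\<kappa> i. \<kappa> \<in> xx 0 ` {1..<n} \<union> xy 0 ` {0..<n} \<Longrightarrow>
      \<exists>j k. {P j, P k} \<in> T i \<and> xx j k = \<kappa> \<or> {Q j, Q k} \<in> T i \<and> yy j k = \<kappa>
        \<or> {P j, Q k} \<in> T i \<and> xy j k = \<kappa>"
    and cover: "complete_edges (carrier G) \<subseteq> (\<Union>i\<in>{0..<n}. T i)"
  shows "\<exists>F S. one_factorization (carrier G) F \<and> G_regular G F
               \<and> complete_rainbow_set (carrier G) F S"
proof -
  \<comment> \<open>The index forgets the coset, which membership in \<open>range P\<close>
    recovers. Between the cosets the exponent of the \<open>P\<close> vertex always comes first in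
    \<open>xy\<close>.\<close>
  define c where "c v w = (if v \<in> range P
      then if w \<in> range P then xx (idx v) (idx w) else xy (idx v) (idx w)
      else if w \<in> range P then xy (idx w) (idx v) else yy (idx v) (idx w))" for v w
  have [simp]: "Q i \<notin> range P" for i by auto
  have c [simp]: "c (P i) (P j) = xx i j" "c (Q i) (Q j) = yy i j"
      "c (P i) (Q j) = xy i j" "c (Q j) (P i) = xy i j" for i j
    by (simp_all add: c_def period)
  have P0: "P 0 = \<one>" by (simp add: P_def)
  have c1: "c \<one> (P i) = xx 0 i" "c \<one> (Q i) = xy 0 i" for i by (simp_all flip: P0)
  have cases0: "(\<exists>i. v = P i) \<or> (\<exists>i. v = Q i)" if "v \<in> carrier G" for v
    using carrier_cases[OF that, of 0] by metis
  have cases1: "(\<exists>i\<in>{1..<n}. v = P i) \<or> (\<exists>i\<in>{0..<n}. v = Q i)" if v: "v \<in> carrier G - {\<one>}" for v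
  proof -
    from v have "v \<in> carrier G" by simp
    then show ?thesis
    proof (cases rule: carrier_cases[where i = 0])
      case (1 u)
      then have "u \<noteq> 0" using v P0 by auto
      with 1 show ?thesis by auto
    next
      case (2 u)
      then show ?thesis by auto
    qed
  qed
  \<comment> \<open>Elements inducing a map on colours are closed under products, so it suffices to
    treat \<open>a\<close> and \<open>b\<close>.\<close>
  let ?act = "\<lambda>h. \<exists>\<phi>. \<forall>x\<in>carrier G. \<forall>y\<in>carrier G. x \<noteq> y \<longrightarrow> c (x \<otimes> h) (y \<otimes> h) = \<phi> (c x y)"
  have act_mult: "?act (h1 \<otimes> h2)" if h: "h1 \<in> carrier G" "h2 \<in> carrier G" "?act h1" "?act h2" for h1 h2
  proof -
    from h(3) obtain \<phi>1 where 1: "\<forall>x\<in>carrier G. \<forall>y\<in>carrier G. x \<noteq> y \<longrightarrow> c (x \<otimes> h1) (y \<otimes> h1) = \<phi>1 (c x y)"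
      by blast
    from h(4) obtain \<phi>2 where 2: "\<forall>x\<in>carrier G. \<forall>y\<in>carrier G. x \<noteq> y \<longrightarrow> c (x \<otimes> h2) (y \<otimes> h2) = \<phi>2 (c x y)"
      by blast
    have "c (x \<otimes> (h1 \<otimes> h2)) (y \<otimes> (h1 \<otimes> h2)) = \<phi>2 (\<phi>1 (c x y))"
      if "x \<in> carrier G" "y \<in> carrier G" "x \<noteq> y" for x y
    proof -
      have "c (x \<otimes> h1 \<otimes> h2) (y \<otimes> h1 \<otimes> h2) = \<phi>2 (c (x \<otimes> h1) (y \<otimes> h1))"
        using 2 h(1) that by simp
      also have "c (x \<otimes> h1) (y \<otimes> h1) = \<phi>1 (c x y)" using 1 that by blast
      finally show ?thesis using that h by (simp add: m_assoc)
    qed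
    then show ?thesis by (intro exI[of _ "\<phi>2 \<circ> \<phi>1"]) simp
  qed
  have acts: "?act a"
    by (rule exI[of _ \<phi>]) (auto dest!: cases0 simp: P_mult_a Q_mult_a act_a P_eq_iff Q_eq_iff)
  have actsb: "?act b"
    by (rule exI[of _ \<psi>]) (auto dest!: cases0 simp: P_mult_b Q_mult_b act_b P_eq_iff Q_eq_iff)
  have "?act \<one>" by (rule exI[of _ id]) simp
  then have act_P: "?act (P (int k))" for k
  proof (induction k)
    case (Suc k)
    then show ?case
      using act_mult[OF P_closed a_closed _ acts, of "int k"]
      by (simp add: P_mult_a add.commute)
  qed (simp add: P0)
  have act_Q: "?act (Q (int k))" for k
    using act_mult[OF b_closed P_closed actsb act_P, of k] by (simp add: Q_def P_def)
  have act: "?act h" if "h \<in> carrier G" for h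
    using carrier_cases[OF that, of 0]
  proof cases
    case (1 u)
    then show ?thesis using act_P[of "nat u"] by simp
  next
    case (2 u)
    then show ?thesis using act_Q[of "nat u"] by simp
  qed
  show ?thesis
  proof (rule regular_factorization_with_trees[where c = c and T = T and I = "{0..<n}" and n = "nat n"])
    show "inj_on (c \<one>) (carrier G - {\<one>})"
    proof (rule inj_onI)
      fix v w assume vw: "v \<in> carrier G - {\<one>}" "w \<in> carrier G - {\<one>}" "c \<one> v = c \<one> w"
      from cases1[OF vw(1)] show "v = w"
      proof (elim disjE bexE)
        fix i assume i: "i \<in> {1..<n}" "v = P i"
        from cases1[OF vw(2)] show ?thesis
          using vw(3) inj(1)[OF i(1)] inj(3)[OF i(1)] by (elim disjE bexE) (auto simp: i c1)
      next
        fix i assume i: "i \<in> {0..<n}" "v = Q i"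
        from cases1[OF vw(2)] show ?thesis
          using vw(3) inj(2)[OF i(1)] inj(3)[OF _ i(1), symmetric]
          by (elim disjE bexE) (auto simp: i c1)
      qed
    qed
    show "c x y = c y x" if "x \<in> carrier G" "y \<in> carrier G" for x y
      using cases0[OF that(1)] cases0[OF that(2)] sym by auto
    show "connected_on (carrier G) (T i)" for i
      by (rule connected_onI[of _ "P i"]) (use conn in \<open>auto elim!: carrier_cases[where i = i]\<close>)
    show "\<exists>x y. {x, y} \<in> T i \<and> c x y = c \<one> w" if "w \<in> carrier G - {\<one>}" for i w
    proof -
      have "c \<one> w \<in> xx 0 ` {1..<n} \<union> xy 0 ` {0..<n}"
        using cases1[OF that] by (auto simp: c1)
      from hits[OF this, of i] show ?thesis using c by metis
    qed
  qed (use act T cover order_G finite_carrier in \<open>auto intro: group_axioms\<close>)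
qed

end

section \<open>The square of \<open>b\<close> is \<open>1\<close> or the central involution\<close>

lemma mod_add_multipleI: "x = y + k * n \<Longrightarrow> x mod n = y mod n" for x y k n :: int
  by simp

locale square_central = cyclic_index_two +
  fixes s :: int
  assumes n_eq: "n = 2 * s" and s_ge: "s \<ge> 2"
    and g_cases: "g = 0 \<or> g = s"
    and r_r: "r * r mod n = 1"
begin

section \<open>Divisibility by \<open>s\<close>\<close>

lemma s_dvd_n: "s dvd n" using n_eq by simp

lemma s_dvd_mod [simp]: "s dvd x mod n \<longleftrightarrow> s dvd x"
  using s_dvd_n by (simp add: dvd_mod_iff)

lemma s_dvd_diff_mod [simp]: "s dvd x mod n - y mod n \<longleftrightarrow> s dvd x - y"
proof -
  have "s dvd (x mod n - y mod n) mod n \<longleftrightarrow> s dvd x - y"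
    by (simp only: mod_diff_eq s_dvd_mod)
  then show ?thesis by (simp only: s_dvd_mod)
qed

lemma s_dvd_cases:
  assumes "s dvd x" "0 \<le> x" "x < n"
  shows "x = 0 \<or> x = s"
proof -
  from assms(1) obtain k where k: "x = s * k" ..
  have "0 \<le> k" using assms(2) s_ge k by (simp add: zero_le_mult_iff)
  moreover have "k < 2" using assms(3) s_ge unfolding k n_eq by simp
  ultimately have "k = 0 \<or> k = 1" by linarith
  then show ?thesis using k by auto
qed

lemma s_dvd_g: "s dvd g" using g_cases by auto

text \<open>\<open>r\<close> is its own inverse modulo \<open>n\<close>, hence a unit modulo
  \<open>s\<close>.\<close>

lemma s_dvd_r: "s dvd r * x \<longleftrightarrow> s dvd x"
proof
  assume "s dvd r * x"
  then have "s dvd r * (r * x)" by simp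
  then have "s dvd (r * r mod n) * x"
    using s_dvd_mod by (metis mod_mult_left_eq mult.assoc)
  then show "s dvd x" by (simp add: r_r)
qed simp

text \<open>Since \<open>n\<close> is even, \<open>r\<close> is odd, and an odd multiple of
  \<open>s\<close> is \<open>s\<close> modulo \<open>2 * s\<close>.\<close>

lemma r_g: "\<exists>k. r * g = g + k * n"
proof -
  have "odd (r * r)" using r_r n_eq by (metis dvd_mod_iff dvd_triv_left odd_one)
  then obtain k where k: "r = 2 * k + 1" by (auto elim!: oddE)
  show ?thesis using g_cases
  proof
    assume "g = s"
    then show ?thesis by (intro exI[of _ k]) (simp add: k n_eq algebra_simps)
  qed (auto intro: exI[of _ 0])
qed

text \<open>Colour \<open>(2, 0)\<close> belongs to the edges \<open>{x, x a^s}\<close>, \<open>(0, t)\<close> to a sum and \<open>(1, d)\<close> to a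
  difference. The sum \<open>t\<close> leaves unmatched, in either coset, the \<open>i\<close> with \<open>2 i = t\<close> or \<open>2 i = t + s\<close>
  modulo \<open>n\<close>; they are matched by the edges of difference \<open>0\<close> and \<open>s\<close>.\<close>

definition xx :: "int \<Rightarrow> int \<Rightarrow> nat \<times> int" where
  "xx i j = (if s dvd i - j then (2, 0) else (0, (i + j) mod n))"

text \<open>The shift by \<open>g\<close> makes \<open>b\<close> act on sums by the same map
  \<open>t |-> r * t + g\<close> from either coset.\<close>

definition yy :: "int \<Rightarrow> int \<Rightarrow> nat \<times> int" where
  "yy i j = (if s dvd i - j then (2, 0) else (0, (i + j + g) mod n))"

definition xy :: "int \<Rightarrow> int \<Rightarrow> nat \<times> int" where
  "xy i j = (if s dvd j - i then (0, (i + j) mod n) else (1, (j - i) mod n))"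

text \<open>\<open>row q\<close> is the position, relative to \<open>i\<close>, of the tree edge with difference \<open>g + q\<close>. The
  component that only the edge \<open>{x, x a^s}\<close> joins to \<open>P i\<close> is \<open>{P (i + s), Q (i + g + 1)}\<close>.\<close>

definition row :: "int \<Rightarrow> int" where
  "row q = (if q = 1 then -1 else if q = s + 1 then s else if q > s then s - q else 0)"

text \<open>The half stars run in opposite directions: relative to \<open>2 * i\<close>, their sums
  are \<open>1\<close> to \<open>s - 1\<close> and \<open>s + 1\<close> to \<open>n - 1\<close>. The
  sums \<open>0\<close> and \<open>s\<close> come from the edges between the cosets with
  \<open>q = 0\<close> and \<open>q = s\<close>. The four pieces have at most
  \<open>2 * n - 1\<close> edges together.\<close>

definition tree :: "int \<Rightarrow> 'a set set" where
  "tree i = (\<lambda>d. {P i, P (i + d)}) ` {1..<s} \<union> (\<lambda>d. {Q i, Q (i + g - d)}) ` {1..<s}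
     \<union> (\<lambda>q. {P (i + row q), Q (i + row q + g + q)}) ` {0..<n}
     \<union> {if i < s then {P i, P (i + s)} else {Q (i + g + 1), Q (i + g + 1 + s)}}"

section \<open>The trees of the first case: edges, connectivity, colours, covering\<close>

lemma tree_P: "1 \<le> d \<Longrightarrow> d < s \<Longrightarrow> x mod n = (i + d) mod n \<Longrightarrow> {P i, P x} \<in> tree i"
  unfolding tree_def using P_cong[of x "i + d"] by auto

lemma tree_Q: "1 \<le> d \<Longrightarrow> d < s \<Longrightarrow> x mod n = (i + g - d) mod n \<Longrightarrow> {Q i, Q x} \<in> tree i"
  unfolding tree_def using Q_cong[of x "i + g - d"] by auto

lemma tree_PQ:
  "0 \<le> q \<Longrightarrow> q < n \<Longrightarrow> x mod n = (i + row q) mod n \<Longrightarrow> y mod n = (i + row q + g + q) mod n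
    \<Longrightarrow> {P x, Q y} \<in> tree i"
  unfolding tree_def using P_cong[of x "i + row q"] Q_cong[of y "i + row q + g + q"] by auto

lemma tree_special:
  "(if i < s then {P i, P (i + s)} else {Q (i + g + 1), Q (i + g + 1 + s)}) \<in> tree i"
  unfolding tree_def by blast

lemma tree_edges: "tree i \<subseteq> complete_edges (carrier G)"
proof -
  have *: "x mod n \<noteq> (x + d) mod n" if "\<not> n dvd d" for x d
  proof
    assume "x mod n = (x + d) mod n"
    then have "n dvd x - (x + d)" by (simp add: mod_eq_dvd_iff)
    with that show False by simp
  qed
  have nd: "\<not> n dvd d" "\<not> s dvd d" if "1 \<le> d" "d < s" for d
    using that n_eq zdvd_not_zless[of d s] s_dvd_n dvd_trans by auto
  have ns: "\<not> n dvd s" using zdvd_not_zless[of s n] n_eq s_ge by auto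
  have "{P i, P (i + d)} \<in> complete_edges (carrier G)" if "1 \<le> d" "d < s" for d
    using nd[OF that] * by (intro P_edge) auto
  moreover have "{Q i, Q (i + g - d)} \<in> complete_edges (carrier G)" if d: "1 \<le> d" "d < s" for d
  proof -
    have "\<not> s dvd g - d" using nd[OF d] s_dvd_g by (metis dvd_diff_right_iff)
    then have "\<not> n dvd g - d" using s_dvd_n dvd_trans by blast
    then show ?thesis using *[of "g - d" i] by (intro Q_edge) (simp add: algebra_simps)
  qed
  moreover have "{P i, P (i + s)} \<in> complete_edges (carrier G)"
    using ns * by (intro P_edge) auto
  moreover have "{Q (i + g + 1), Q (i + g + 1 + s)} \<in> complete_edges (carrier G)"
    using ns * by (intro Q_edge) auto
  ultimately show ?thesis
    unfolding tree_def using PQ_edge by (auto split: if_splits)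
qed

lemma tree_card: "card (tree i) \<le> 2 * nat n - 1"
proof -
  have "card (tree i) \<le> (nat (s - 1) + nat (s - 1)) + nat n + 1"
    unfolding tree_def
    by (intro order.trans[OF card_Un_le] add_mono order.trans[OF card_image_le]) auto
  then show ?thesis using s_ge n_eq by linarith
qed

text \<open>The vertices \<open>Q (i + g)\<close> and \<open>Q (i + g + s)\<close> are adjacent to
  \<open>P i\<close>, and one of them is \<open>Q i\<close>, the centre of the other half star. The
  vertices \<open>P (i + u)\<close> with \<open>u > s\<close> hang on these two. Only
  \<open>P (i + s)\<close> and \<open>Q (i + g + 1)\<close>, joined to each other by
  \<open>link\<close>, then wait for the special edge.\<close>

lemma tree_connected:
  assumes u: "0 \<le> u" "u < n"
  shows "(P i, P (i + u)) \<in> (adj (tree i))\<^sup>*" "(P i, Q (i + u)) \<in> (adj (tree i))\<^sup>*"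
proof -
  let ?R = "(adj (tree i))\<^sup>*"
  have star: "(P i, P (i + u)) \<in> ?R" if "0 \<le> u" "u < s" for u
  proof (cases "u = 0")
    case False
    then have "{P i, P (i + u)} \<in> tree i" using that by (intro tree_P) auto
    then show ?thesis by (rule adj_rtrancl_edge)
  qed simp
  have Q_direct: "(P i, Q (i + g + q)) \<in> ?R" if "q = 0 \<or> q = s \<or> 2 \<le> q \<and> q < s" for q
    using that s_ge n_eq
    by (intro adj_rtrancl_edge[OF tree_PQ[of q]]) (auto simp: row_def)
  have Q0: "(P i, Q i) \<in> ?R"
    using g_cases
  proof
    assume "g = s"
    then have "Q i = Q (i + g + s)" by (intro Q_cong mod_add_multipleI[of _ _ "-1"]) (simp add: n_eq)
    then show ?thesis using Q_direct[of s] by simp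
  qed (use Q_direct[of 0] in simp)
  have Q_star: "(P i, Q (i + g + u)) \<in> ?R" if "s < u" "u < n" for u
  proof (rule adj_rtrancl_step[OF Q0 disjI1[OF tree_Q[of "n - u"]]])
    show "(i + g + u) mod n = (i + g - (n - u)) mod n"
      by (rule mod_add_multipleI[of _ _ 1]) simp
  qed (use that n_eq in auto)
  have P_far: "(P i, P (i + u)) \<in> ?R" if "s < u" "u < n" for u
  proof (cases "u = n - 1")
    case True
    have "{P (i + u), Q (i + g)} \<in> tree i"
    proof (rule tree_PQ[of 1])
      show "(i + u) mod n = (i + row 1) mod n"
        by (rule mod_add_multipleI[of _ _ 1]) (simp add: row_def True)
    qed (use n_eq s_ge in \<open>auto simp: row_def\<close>)
    then show ?thesis using Q_direct[of 0] by (auto intro: adj_rtrancl_step)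
  next
    case False
    have q: "row (s + n - u) = u - n"
      using that False n_eq by (auto simp: row_def)
    have "{P (i + u), Q (i + g + s)} \<in> tree i"
    proof (rule tree_PQ[of "s + n - u"])
      show "(i + u) mod n = (i + row (s + n - u)) mod n"
        by (rule mod_add_multipleI[of _ _ 1]) (simp add: q)
      have "i + row (s + n - u) + g + (s + n - u) = i + g + s" by (simp add: q)
      then show "(i + g + s) mod n = (i + row (s + n - u) + g + (s + n - u)) mod n" by (simp only:)
    qed (use that n_eq in auto)
    then show ?thesis using Q_direct[of s] by (auto intro: adj_rtrancl_step)
  qed
  have link: "{P (i + s), Q (i + g + 1)} \<in> tree i"
  proof (rule tree_PQ[of "s + 1"])
    show "(i + g + 1) mod n = (i + row (s + 1) + g + (s + 1)) mod n"
      using s_ge by (intro mod_add_multipleI[of _ _ "-1"]) (simp add: row_def n_eq)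
  qed (use s_ge n_eq in \<open>auto simp: row_def\<close>)
  have both: "(P i, P (i + s)) \<in> ?R \<and> (P i, Q (i + g + 1)) \<in> ?R"
  proof (cases "i < s")
    case True
    then have "(P i, P (i + s)) \<in> ?R"
      using tree_special[of i] by (intro adj_rtrancl_edge) simp
    then show ?thesis using link by (auto intro: adj_rtrancl_step)
  next
    case False
    have "(P i, Q (i + g + 1 + s)) \<in> ?R"
      using Q_star[of "s + 1"] s_ge n_eq by (simp add: algebra_simps)
    then have "(P i, Q (i + g + 1)) \<in> ?R"
      using False tree_special[of i] by (auto intro: adj_rtrancl_step)
    then show ?thesis using link by (auto intro: adj_rtrancl_step)
  qed
  show "(P i, P (i + u)) \<in> ?R"
    using star[of u] P_far[of u] both u by (cases "u < s"; cases "u = s") auto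
  have all: "(P i, Q (i + g + u)) \<in> ?R" if u: "0 \<le> u" "u < n" for u
  proof -
    consider "u = 0 \<or> u = s \<or> 2 \<le> u \<and> u < s" | "u = 1" | "s < u" using u by linarith
    then show ?thesis using Q_direct[of u] Q_star[of u] both u by cases auto
  qed
  have "Q (i + u) = Q (i + g + (u - g) mod n)"
    by (rule Q_cong) (simp add: mod_simps)
  then show "(P i, Q (i + u)) \<in> ?R"
    using all[of "(u - g) mod n"] n_pos by simp
qed

lemma not_s_dvd: "0 < d \<Longrightarrow> d < n \<Longrightarrow> d \<noteq> s \<Longrightarrow> \<not> s dvd d"
  using s_dvd_cases[of d] by auto

lemma tree_hits:
  assumes "\<kappa> \<in> xx 0 ` {1..<n} \<union> xy 0 ` {0..<n}"
  shows "\<exists>j k. {P j, P k} \<in> tree i \<and> xx j k = \<kappa> \<or> {Q j, Q k} \<in> tree i \<and> yy j k = \<kappa>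
    \<or> {P j, Q k} \<in> tree i \<and> xy j k = \<kappa>"
proof -
  from assms consider "\<kappa> = (2, 0)" | t where "0 \<le> t" "t < n" "\<kappa> = (0, t)"
    | d where "0 \<le> d" "d < n" "\<not> s dvd d" "\<kappa> = (1, d)"
    using n_pos by (auto simp: xx_def xy_def split: if_splits)
  then show ?thesis
  proof cases
    case 1
    have "xx i (i + s) = \<kappa>" "yy (i + g + 1) (i + g + 1 + s) = \<kappa>"
      using 1 by (auto simp: xx_def yy_def)
    then show ?thesis using tree_special[of i] by (cases "i < s") auto
  next
    case (2 t)
    define u where "u = (t - 2 * i) mod n"
    have u: "0 \<le> u" "u < n" using n_pos by (auto simp: u_def)
    have t: "(2 * i + u) mod n = t" using 2 by (simp add: u_def mod_simps)
    consider "u = 0 \<or> u = s" | "1 \<le> u" "u < s" | "s < u" using u by linarith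
    then show ?thesis
    proof cases
      case 1
      \<comment> \<open>Both \<open>u\<close> and \<open>g\<close> are \<open>0\<close> or
        \<open>s\<close>, so this \<open>q\<close> is \<open>0\<close> or \<open>s\<close> as well
        and solves \<open>g + q = u\<close> modulo \<open>n\<close>.\<close>
      define q where "q = \<bar>u - g\<bar>"
      have q: "q = 0 \<or> q = s" using 1 g_cases s_ge by (auto simp: q_def)
      have "\<exists>k. g + q = u + k * n"
        using 1 g_cases s_ge n_eq unfolding q_def
        by (auto intro: exI[of _ 0] exI[of _ 1])
      then obtain k where k: "g + q = u + k * n" ..
      have "{P i, Q (i + g + q)} \<in> tree i"
        using q s_ge n_eq by (intro tree_PQ[of q]) (auto simp: row_def)
      moreover have "xy i (i + g + q) = \<kappa>"
      proof -
        have "s dvd (i + g + q) - i" using q s_dvd_g by auto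
        moreover have "(i + (i + g + q)) mod n = (2 * i + u) mod n"
          using k by (intro mod_add_multipleI[of _ _ k]) simp
        ultimately show ?thesis using 2 t by (simp add: xy_def)
      qed
      ultimately show ?thesis by blast
    next
      case 2
      have "xx i (i + u) = \<kappa>"
        using not_s_dvd[of u] 2 u \<open>\<kappa> = (0, t)\<close> t by (simp add: xx_def algebra_simps)
      moreover have "{P i, P (i + u)} \<in> tree i" using 2 by (intro tree_P) auto
      ultimately show ?thesis by blast
    next
      case 3
      have "\<not> s dvd i - (i + g - (n - u))"
      proof
        assume "s dvd i - (i + g - (n - u))"
        then have "s dvd n - g - u" by (simp add: algebra_simps)
        then have "s dvd u" using s_dvd_n s_dvd_g by (metis dvd_diff dvd_diff_right_iff)
        then show False using not_s_dvd[of u] 3 u s_ge by auto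
      qed
      moreover have "(i + (i + g - (n - u)) + g) mod n = (2 * i + u) mod n"
        using g_cases n_eq
        by (elim disjE) (auto intro: mod_add_multipleI[of _ _ "-1"])
      ultimately have "yy i (i + g - (n - u)) = \<kappa>"
        using \<open>\<kappa> = (0, t)\<close> t by (simp add: yy_def)
      moreover have "{Q i, Q (i + g - (n - u))} \<in> tree i"
        using 3 u n_eq by (intro tree_Q) auto
      ultimately show ?thesis by blast
    qed
  next
    case (3 d)
    define q where "q = (d - g) mod n"
    have q: "0 \<le> q" "q < n" using n_pos by (auto simp: q_def)
    have "(g + q) mod n = d" using 3 by (simp add: q_def mod_simps)
    then have "xy (i + row q) (i + row q + g + q) = \<kappa>"
      using 3 s_dvd_mod[of "g + q"] by (simp add: xy_def)
    with tree_PQ[OF q refl refl] show ?thesis by blast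
  qed
qed

lemma tree_cover: "complete_edges (carrier G) \<subseteq> (\<Union>i\<in>{0..<n}. tree i)"
proof
  fix e assume "e \<in> complete_edges (carrier G)"
  then show "e \<in> (\<Union>i\<in>{0..<n}. tree i)"
  proof (cases rule: edge_cases)
    case (1 i u)
    consider "u < s" | "u = s" using 1 n_eq by linarith
    then show ?thesis
    proof cases
      case a: 1
      have "{P (i mod n), P (i + u)} \<in> tree (i mod n)"
        using 1 a by (intro tree_P) (auto simp: mod_simps)
      then show ?thesis using 1 n_pos P_cong[of "i mod n" i] by auto
    next
      case a: 2
      \<comment> \<open>Only trees of index below \<open>s\<close> have such an edge in the first
        coset; \<open>j\<close> is the end of the edge in that range.\<close>
      define j where "j = (if i mod n < s then i mod n else i mod n - s)"
      have j: "0 \<le> j" "j < s" using n_pos n_eq pos_mod_bound[of n i] by (auto simp: j_def)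
      have "{P j, P (j + s)} = e"
      proof (cases "i mod n < s")
        case True
        then have "P j = P i" "P (j + s) = P (i + s)"
          by (auto intro!: P_cong simp: j_def mod_simps)
        then show ?thesis using 1 a by simp
      next
        case False
        have "P j = P (i + s)" using False
          by (intro P_cong) (simp add: j_def mod_simps, rule mod_add_multipleI[of _ _ "-1"], simp add: n_eq)
        moreover have "P (j + s) = P i" using False by (intro P_cong) (simp add: j_def)
        ultimately show ?thesis using 1 a by auto
      qed
      then have "e \<in> tree j" using tree_special[of j] j by simp
      then show ?thesis using j n_eq by auto
    qed
  next
    case (2 i u)
    have main: "{Q x, Q y} \<in> (\<Union>i\<in>{0..<n}. tree i)" if "(x + g - y) mod n \<in> {1..<s}" for x y
    proof -
      have "{Q (x mod n), Q y} \<in> tree (x mod n)"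
      proof (rule tree_Q[of "(x + g - y) mod n"])
        show "y mod n = (x mod n + g - (x + g - y) mod n) mod n" by (simp add: mod_simps)
      qed (use that in auto)
      then show ?thesis using n_pos Q_cong[of "x mod n" x] by auto
    qed
    show ?thesis
    proof (cases "u = s")
      case True
      \<comment> \<open>Of the two indices whose special edge could be this one, the one not below
        \<open>s\<close>.\<close>
      define j where "j = (let k = (i - g - 1) mod n in if k < s then k + s else k)"
      have j: "s \<le> j" "j < n" "0 \<le> j"
        using n_pos n_eq s_ge pos_mod_bound[of n "i - g - 1"] by (auto simp: j_def Let_def)
      have "{Q (j + g + 1), Q (j + g + 1 + s)} = e"
      proof (cases "(i - g - 1) mod n < s")
        case True
        have "(j + g + 1) mod n = (i + s) mod n"
        proof -
          have "j + g + 1 = (i - g - 1) mod n + (s + g + 1)" using True by (simp add: j_def)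
          then have "(j + g + 1) mod n = (i - g - 1 + (s + g + 1)) mod n" by (simp only: mod_add_left_eq)
          then show ?thesis by simp
        qed
        moreover have "(j + g + 1 + s) mod n = i mod n"
        proof -
          have "j + g + 1 + s = (i - g - 1) mod n + (n + g + 1)" using True by (simp add: j_def n_eq)
          then have "(j + g + 1 + s) mod n = (i - g - 1 + (n + g + 1)) mod n"
            by (simp only: mod_add_left_eq)
          then show ?thesis by simp
        qed
        ultimately have "Q (j + g + 1) = Q (i + s)" "Q (j + g + 1 + s) = Q i"
          by (auto intro: Q_cong)
        then show ?thesis using 2 \<open>u = s\<close> by auto
      next
        case False
        have "(j + g + 1) mod n = i mod n"
        proof -
          have "j + g + 1 = (i - g - 1) mod n + (g + 1)" using False by (simp add: j_def)
          then have "(j + g + 1) mod n = (i - g - 1 + (g + 1)) mod n" by (simp only: mod_add_left_eq)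
          then show ?thesis by simp
        qed
        moreover have "(j + g + 1 + s) mod n = (i + s) mod n"
          using \<open>(j + g + 1) mod n = i mod n\<close> by (metis mod_add_left_eq)
        ultimately have "Q (j + g + 1) = Q i" "Q (j + g + 1 + s) = Q (i + s)"
          by (auto intro: Q_cong)
        then show ?thesis using 2 \<open>u = s\<close> by simp
      qed
      then have "e \<in> tree j" using tree_special[of j] j by simp
      then show ?thesis using j by auto
    next
      case False
      have 1: "(i + g - (i + u)) mod n = (g - u) mod n" "(i + u + g - i) mod n = (g + u) mod n"
        by simp_all (simp add: add.commute)
      \<comment> \<open>For \<open>g = s\<close> the edge belongs to the half star at its earlier
        end, for \<open>g = 0\<close> to the one at its later end.\<close>
      have "(g - u) mod n \<in> {1..<s} \<or> (g + u) mod n \<in> {1..<s}"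
        using g_cases
      proof
        assume "g = 0"
        then show ?thesis using 2 \<open>u \<noteq> s\<close> n_eq by simp
      next
        assume "g = s"
        then show ?thesis using 2 \<open>u \<noteq> s\<close> n_eq by simp
      qed
      then show ?thesis
        using main[of i "i + u"] main[of "i + u" i] 2 by (simp only: 1) (auto simp: insert_commute)
    qed
  next
    case (3 i j)
    \<comment> \<open>The difference determines the row, and the position of the \<open>P\<close>
      end then determines the tree.\<close>
    define q where "q = (j - i - g) mod n"
    define k where "k = (i - row q) mod n"
    have q: "0 \<le> q" "q < n" using n_pos by (auto simp: q_def)
    have "{P i, Q j} \<in> tree k"
    proof (rule tree_PQ[OF q])
      show "i mod n = (k + row q) mod n" by (simp add: k_def mod_simps)
      show "j mod n = (k + row q + g + q) mod n"
      proof -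
        have "(k + row q + g + q) mod n = ((i - row q) mod n + (row q + g) + (j - i - g) mod n) mod n"
          by (simp add: k_def q_def algebra_simps)
        also have "\<dots> = j mod n" by (simp add: mod_simps)
        finally show ?thesis by simp
      qed
    qed
    then show ?thesis using 3 n_pos by (auto simp: k_def)
  qed
qed

theorem factorization:
  "\<exists>F S. one_factorization (carrier G) F \<and> G_regular G F \<and> complete_rainbow_set (carrier G) F S"
proof -
  \<comment> \<open>The maps on colours induced by \<open>a\<close> and \<open>b\<close>:
    \<open>a\<close> raises sums by 2 and keeps differences, \<open>b\<close> exchanges the cosets
    and so reverses differences.\<close>
  define \<phi> :: "nat \<times> int \<Rightarrow> nat \<times> int"
    where "\<phi> = (\<lambda>(k, t). if k = 0 then (0, (t + 2) mod n) else (k, t))"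
  define \<psi> :: "nat \<times> int \<Rightarrow> nat \<times> int"
    where "\<psi> = (\<lambda>(k, t). if k = 0 then (0, (r * t + g) mod n)
      else if k = 1 then (1, (- r * t - g) mod n) else (k, t))"
  obtain k where k: "r * g = g + k * n" using r_g by blast
  show ?thesis
  proof (rule factorization_from_indices[of xx yy xy \<phi> \<psi> tree])
    show "xx i j = xx j i" "yy i j = yy j i" for i j
      by (auto simp: xx_def yy_def dvd_diff_commute add.commute)
    show "xx (i mod n) (j mod n) = xx i j" "yy (i mod n) (j mod n) = yy i j"
      "xy (i mod n) (j mod n) = xy i j" for i j
      using mod_add_left_eq[of "i mod n + j mod n" n g] mod_add_left_eq[of "i + j" n g]
      by (simp_all add: xx_def yy_def xy_def mod_simps)
    show "i = j" if "i \<in> {1..<n}" "j \<in> {1..<n}" "xx 0 i = xx 0 j" for i j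
      using that s_dvd_cases[of i] s_dvd_cases[of j] by (auto simp: xx_def split: if_splits)
    show "i = j" if "i \<in> {0..<n}" "j \<in> {0..<n}" "xy 0 i = xy 0 j" for i j
      using that by (auto simp: xy_def split: if_splits)
    show "xx 0 i \<noteq> xy 0 j" if "i \<in> {1..<n}" "j \<in> {0..<n}" for i j
      using that by (auto simp: xx_def xy_def)
    show "xx (i + 1) (j + 1) = \<phi> (xx i j)" "yy (i + 1) (j + 1) = \<phi> (yy i j)"
      "xy (i + 1) (j + 1) = \<phi> (xy i j)" for i j
      by (auto simp: xx_def yy_def xy_def \<phi>_def mod_simps algebra_simps)
    show "yy (r * i) (r * j) = \<psi> (xx i j)" for i j
      using s_dvd_r[of "i - j"]
      by (auto simp: xx_def yy_def \<psi>_def mod_affine distrib_left right_diff_distrib)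
    show "xx (r * i + g) (r * j + g) = \<psi> (yy i j)" for i j
    proof -
      have "(r * i + g + (r * j + g)) mod n = (r * (i + j + g) + g) mod n"
        by (rule mod_add_multipleI[of _ _ "-k"]) (simp add: distrib_left k)
      then show ?thesis
        using s_dvd_r[of "i - j"] by (auto simp: xx_def yy_def \<psi>_def mod_affine right_diff_distrib)
    qed
    show "xy (r * j + g) (r * i) = \<psi> (xy i j)" for i j
    proof -
      have "s dvd r * i - (r * j + g) \<longleftrightarrow> s dvd r * (j - i)"
        using s_dvd_g by (smt (verit) dvd_add_left_iff dvd_diff_commute right_diff_distrib)
      moreover have "(r * j + g + r * i) mod n = (r * ((i + j) mod n) + g) mod n"
        using mod_affine[of r "i + j" n g] by (simp add: algebra_simps)
      moreover have "(r * i - (r * j + g)) mod n = (- r * ((j - i) mod n) - g) mod n"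
      proof -
        have "- r * ((j - i) mod n) - g = - r * ((j - i) mod n) + - g" by simp
        also have "\<dots> mod n = (- r * (j - i) + - g) mod n" by (rule mod_affine)
        also have "- r * (j - i) + - g = r * i - (r * j + g)" by (simp add: algebra_simps)
        finally show ?thesis ..
      qed
      ultimately show ?thesis
        using s_dvd_r[of "j - i"] by (auto simp: xy_def \<psi>_def)
    qed
  qed (use tree_edges tree_card tree_connected tree_hits tree_cover in auto)
qed

end

section \<open>Cyclic groups\<close>

text \<open>With \<open>r = 1\<close> and \<open>g = 1\<close>, \<open>b\<close> commutes with
  \<open>a\<close> and has square \<open>a\<close>, so \<open>b\<close> generates the group.\<close>

locale square_generator = cyclic_index_two G a b n 1 1 for G (structure) and a b and n :: int +
  fixes m :: int
  assumes odd_m: "odd m" and m_ge: "m \<ge> 3" and dvd_n: "4 * m dvd n"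
begin

text \<open>\<open>2 * w\<close> plays the part of \<open>s\<close> in the first case, so
  \<open>a [^] (2 * w)\<close> is the involution.\<close>

definition w :: int where "w = n div 4"
definition \<mu> :: int where "\<mu> = m div 2"

lemma n_eq: "n = 4 * w" and m_dvd: "m dvd w"
proof -
  obtain c where "n = 4 * m * c" using dvd_n ..
  then show "n = 4 * w" "m dvd w" unfolding w_def by simp_all
qed

lemma m_eq: "m = 2 * \<mu> + 1"
  using odd_m by (simp add: \<mu>_def)

lemma \<mu>_ge: "\<mu> \<ge> 1" and w_ge: "w \<ge> 2 * \<mu> + 1"
proof -
  show "\<mu> \<ge> 1" using m_eq m_ge by linarith
  have "w > 0" using n_pos n_eq by linarith
  then show "w \<ge> 2 * \<mu> + 1" using m_dvd zdvd_imp_le[of m w] m_eq by linarith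
qed

lemmas size = n_eq \<mu>_ge w_ge

lemma mod_n_mod_m [simp]: "x mod n mod m = x mod m"
proof -
  have "m dvd n" using dvd_n by (rule dvd_mult_right)
  then show ?thesis by (rule mod_mod_cancel)
qed

lemma mod_mI: "x mod m = y mod m" if "x = y + l * w + k * m" for x y k l
proof -
  obtain c where "w = m * c" using m_dvd ..
  then have "x = y + (l * c + k) * m" using that by (simp add: algebra_simps)
  then show ?thesis by (rule mod_add_multipleI)
qed

text \<open>With \<open>P i\<close> at position \<open>2 i\<close> and \<open>Q i\<close> at position \<open>2 i + 1\<close> of a cycle of length \<open>2 n\<close>,
  \<open>b\<close> is a rotation by one step. Colours \<open>(0, t)\<close> and \<open>(2, y)\<close> are half the sum of the two
  positions, modulo \<open>n\<close> and modulo \<open>m\<close>, up to a correction for edges between the cosets. A factor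
  of colour \<open>(0, t)\<close> contains edges of every even length except \<open>n\<close> and \<open>2\<close>. The latter two are
  left to the colours \<open>(2, y)\<close>: a reflection of the integers modulo \<open>m\<close> pairs residue classes by a
  length that is fixed modulo \<open>m\<close> only, and all lengths but \<open>2\<close> are chosen odd. This needs \<open>2\<close> to
  be nonzero modulo \<open>m\<close>, hence \<open>m \<noteq> 1\<close>.\<close>

definition exceptional :: "int \<Rightarrow> bool" where
  "exceptional x \<longleftrightarrow> x mod n \<in> {1, n - 1, 2 * w}"

definition xx :: "int \<Rightarrow> int \<Rightarrow> nat \<times> int" where
  "xx i j = (if exceptional (i - j) then (2, (i + j) mod m) else (0, (i + j) mod n))"

definition yy :: "int \<Rightarrow> int \<Rightarrow> nat \<times> int" where
  "yy i j = (if exceptional (i - j) then (2, (i + j + 1) mod m) else (0, (i + j + 1) mod n))"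

text \<open>For even \<open>t\<close>, the sum \<open>t\<close> leaves free \<open>P\<close> at
  \<open>t/2\<close> plus multiples of \<open>w\<close>, and \<open>Q\<close> at \<open>t/2\<close>
  and \<open>t/2 - 1\<close> plus multiples of \<open>2 * w\<close>. The differences
  \<open>0\<close> and \<open>n - 1 - w\<close> match these, which explains the correction
  \<open>1 - w\<close>; odd \<open>t\<close> uses \<open>n - 1\<close> and \<open>w\<close>. The
  \<open>m - 3\<close> middle differences complete the colours \<open>(2, y)\<close>. All ranges are
  invariant under \<open>d |-> n - 1 - d\<close>, the effect of \<open>b\<close>.\<close>

definition xy :: "int \<Rightarrow> int \<Rightarrow> nat \<times> int" where
  "xy i j = (let d = (j - i) mod n in
     if d = 0 \<or> d = n - 1 then (0, (i + j) mod n)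
     else if d = w \<or> d = n - 1 - w then (0, (i + j + 1 - w) mod n)
     else if 2 * w - \<mu> < d \<and> d < 2 * w + \<mu> - 1 then (2, (i + j + \<mu> + 1) mod m)
     else (1, d))"

text \<open>The component that only the edge \<open>{x, x a^s}\<close> joins to \<open>P i\<close> contains \<open>P (i + 2 w)\<close> and
  \<open>Q (i + \<mu>)\<close>.\<close>

definition row :: "int \<Rightarrow> int" where
  "row d = (if d = 0 then 0 else if d = n - 1 then 1 else if d = w then w
     else if d = n - 1 - w then 2 * w else if d \<le> \<mu> \<or> d = w - 1 then - d
     else if d = w + \<mu> then - 1 - d else if d = 2 * w then - w
     else if d < 2 * w then 0 else if d \<le> 2 * w + \<mu> then 2 * w else 2 * w - d)"

text \<open>The half stars omit the exceptional offsets \<open>1\<close> and \<open>2 * w\<close>.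
  The three single edges supply them and have the colours \<open>(2, y)\<close> with
  \<open>y\<close> equal to \<open>1\<close>, \<open>2 * \<mu>\<close> and \<open>0\<close> relative
  to \<open>2 * i\<close>.\<close>

definition tree :: "int \<Rightarrow> 'a set set" where
  "tree i = (\<lambda>d. {P i, P (i + d)}) ` {2..<2 * w} \<union> (\<lambda>d. {Q i, Q (i - d)}) ` {2..<2 * w}
     \<union> (\<lambda>d. {P (i + row d), Q (i + row d + d)}) ` {0..<n}
     \<union> {{P (i + 2 * w), P (i + 2 * w + 1)}, {Q (i + w + \<mu> - 1), Q (i + w + \<mu>)},
        if i < 2 * w then {P i, P (i + 2 * w)} else {Q (i + \<mu>), Q (i + \<mu> + 2 * w)}}"

lemma row_near: "row q = 0" if "q = 0 \<or> \<mu> < q \<and> q < 2 * w \<and> q \<noteq> w - 1 \<and> q \<noteq> w \<and> q \<noteq> w + \<mu>"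
  using that size unfolding row_def by (smt (verit))

lemma row_special:
  "row (n - 1) = 1" "row w = w" "row (n - 1 - w) = 2 * w" "row (w + \<mu>) = - 1 - w - \<mu>" "row (2 * w) = - w"
  using size unfolding row_def by (smt (verit))+

lemma row_neg:
  assumes "1 \<le> p" "p \<le> \<mu> \<or> p = w - 1"
  shows "row p = - p"
proof -
  have "p \<noteq> 0" "p \<noteq> n - 1" "p \<noteq> w" "p \<noteq> n - 1 - w"
    using assms size by linarith+
  with assms show ?thesis by (simp add: row_def)
qed

text \<open>The excluded \<open>p = w - 1\<close> would give the special difference
  \<open>n - 1 - w\<close>.\<close>

lemma row_far:
  assumes "1 \<le> p" "p \<le> 2 * w - 2" "p \<noteq> w - 1"
  shows "row (2 * w + p) = (if p \<le> \<mu> then 2 * w else - p)"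
proof -
  have "2 * w + p \<noteq> 0" "2 * w + p \<noteq> n - 1" "2 * w + p \<noteq> w" "2 * w + p \<noteq> n - 1 - w"
    "\<not> 2 * w + p \<le> \<mu>" "2 * w + p \<noteq> w - 1" "2 * w + p \<noteq> w + \<mu>" "2 * w + p \<noteq> 2 * w"
    "\<not> 2 * w + p < 2 * w"
    using assms size by linarith+
  then show ?thesis by (simp add: row_def)
qed

lemma exceptional_minus: "exceptional (- x) \<longleftrightarrow> exceptional x"
proof -
  have "exceptional (- x)" if "exceptional x" for x
    using that size unfolding exceptional_def by (auto simp: zmod_zminus1_eq_if)
  from this[of x] this[of "- x"] show ?thesis by auto
qed

lemma exceptional_small: "0 \<le> d \<Longrightarrow> d < n \<Longrightarrow> exceptional d \<longleftrightarrow> d \<in> {1, n - 1, 2 * w}"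
  by (simp add: exceptional_def)

lemma xy_shift:
  assumes "0 \<le> d" "d < n"
  shows "xy i (i + d) = (if d = 0 \<or> d = n - 1 then (0, (2 * i + d) mod n)
     else if d = w \<or> d = n - 1 - w then (0, (2 * i + d + 1 - w) mod n)
     else if 2 * w - \<mu> < d \<and> d < 2 * w + \<mu> - 1 then (2, (2 * i + d + \<mu> + 1) mod m)
     else (1, d))"
  using assms by (simp add: xy_def Let_def algebra_simps)

section \<open>The trees of the second case: edges, connectivity, colours, covering\<close>

lemma tree_P: "2 \<le> d \<Longrightarrow> d < 2 * w \<Longrightarrow> x mod n = (i + d) mod n \<Longrightarrow> {P i, P x} \<in> tree i"
  unfolding tree_def using P_cong[of x "i + d"] by auto

lemma tree_Q: "2 \<le> d \<Longrightarrow> d < 2 * w \<Longrightarrow> x mod n = (i - d) mod n \<Longrightarrow> {Q i, Q x} \<in> tree i"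
  unfolding tree_def using Q_cong[of x "i - d"] by auto

lemma tree_PQ:
  "0 \<le> d \<Longrightarrow> d < n \<Longrightarrow> x mod n = (i + row d) mod n \<Longrightarrow> y mod n = (i + row d + d) mod n
    \<Longrightarrow> {P x, Q y} \<in> tree i"
  unfolding tree_def using P_cong[of x "i + row d"] Q_cong[of y "i + row d + d"] by auto

lemma tree_extra:
  "{P (i + 2 * w), P (i + 2 * w + 1)} \<in> tree i" "{Q (i + w + \<mu> - 1), Q (i + w + \<mu>)} \<in> tree i"
  "(if i < 2 * w then {P i, P (i + 2 * w)} else {Q (i + \<mu>), Q (i + \<mu> + 2 * w)}) \<in> tree i"
  unfolding tree_def by blast+

lemma mod_neq: "0 < d \<Longrightarrow> d < n \<Longrightarrow> x mod n \<noteq> (x + d) mod n"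
proof
  assume d: "0 < d" "d < n" and "x mod n = (x + d) mod n"
  then have "n dvd d" by (metis add_diff_cancel_left' mod_eq_dvd_iff)
  with d show False using zdvd_not_zless by blast
qed

lemma P_edge': "0 < d \<Longrightarrow> d < n \<Longrightarrow> {P x, P (x + d)} \<in> complete_edges (carrier G)"
  using mod_neq by (intro P_edge) blast

lemma Q_edge': "0 < d \<Longrightarrow> d < n \<Longrightarrow> {Q x, Q (x + d)} \<in> complete_edges (carrier G)"
  using mod_neq by (intro Q_edge) blast

lemma tree_edges: "tree i \<subseteq> complete_edges (carrier G)"
proof -
  have "{Q i, Q (i - d)} \<in> complete_edges (carrier G)" if "0 < d" "d < n" for d
    using Q_edge'[OF that, of "i - d"] by (simp add: insert_commute)
  moreover have "{Q (i + w + \<mu> - 1), Q (i + w + \<mu>)} \<in> complete_edges (carrier G)"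
    using Q_edge'[of 1 "i + w + \<mu> - 1"] size by simp
  moreover have "{P (i + 2 * w), P (i + 2 * w + 1)} \<in> complete_edges (carrier G)"
    using P_edge'[of 1 "i + 2 * w"] size by simp
  ultimately show ?thesis
    unfolding tree_def using PQ_edge P_edge' Q_edge' size by auto
qed

lemma tree_card: "card (tree i) \<le> 2 * nat n - 1"
proof -
  have "card {x, y, z} \<le> 3" for x y z :: "'a set"
    by (simp add: card_insert_if)
  then have "card (tree i) \<le> (nat (2 * w - 2) + nat (2 * w - 2)) + nat n + 3"
    unfolding tree_def
    by (intro order.trans[OF card_Un_le] add_mono order.trans[OF card_image_le]) auto
  then show ?thesis using size by linarith
qed

lemma tree_PQ':
  "0 \<le> d \<Longrightarrow> d < n \<Longrightarrow> row d = q \<Longrightarrow> x = i + q + k * n \<Longrightarrow> y = i + q + d + l * n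
    \<Longrightarrow> {P x, Q y} \<in> tree i"
  by (rule tree_PQ[of d]) simp_all

text \<open>\<open>Q i\<close> is adjacent to \<open>P i\<close>, and \<open>Q (i + 2 * w)\<close>
  is reached through \<open>P (i + w)\<close>; the far \<open>P\<close> vertices hang on these two.
  The vertices \<open>Q (i + p)\<close> with \<open>1 \<le> p \<le> \<mu>\<close> and
  \<open>Q (i + (w - 1))\<close> hang on \<open>P (i + 2 * w)\<close>, which the special edge
  reaches, directly or through \<open>Q (i + \<mu>)\<close>.\<close>

lemma tree_connected:
  assumes u: "0 \<le> u" "u < n"
  shows "(P i, P (i + u)) \<in> (adj (tree i))\<^sup>*" "(P i, Q (i + u)) \<in> (adj (tree i))\<^sup>*"
proof -
  let ?R = "(adj (tree i))\<^sup>*"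
  note step = adj_rtrancl_step[OF _ disjI1] and step' = adj_rtrancl_step[OF _ disjI2]
  have P_star: "(P i, P (i + u)) \<in> ?R" if "2 \<le> u" "u < 2 * w" for u
    using that by (intro adj_rtrancl_edge tree_P) auto
  have Q_near: "(P i, Q (i + q)) \<in> ?R"
    if "q = 0 \<or> \<mu> < q \<and> q < 2 * w \<and> q \<noteq> w - 1 \<and> q \<noteq> w \<and> q \<noteq> w + \<mu>" for q
    by (rule adj_rtrancl_edge[OF tree_PQ'[of q 0 _ _ 0 _ 0]]) (use that size row_near[OF that] in auto)
  have Q0: "(P i, Q i) \<in> ?R" using Q_near[of 0] by simp
  have Q_star: "(P i, Q (i + u)) \<in> ?R" if "2 * w < u" "u \<le> n - 2" for u
  proof (rule step[OF Q0 tree_Q[of "n - u"]])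
    show "(i + u) mod n = (i - (n - u)) mod n" by (rule mod_add_multipleI[of _ _ 1]) simp
  qed (use that size in linarith)+
  have P1: "(P i, P (i + 1)) \<in> ?R"
    by (rule step'[OF Q0 tree_PQ'[OF _ _ row_special(1), of _ _ 0 _ "-1"]]) (use size in auto)
  have Q2w: "(P i, Q (i + 2 * w)) \<in> ?R"
    by (rule step[OF P_star[of w] tree_PQ'[OF _ _ row_special(2), of _ _ 0 _ 0]]) (use size in auto)
  have P_far: "(P i, P (i + u)) \<in> ?R" if "2 * w + 2 \<le> u" "u < n" for u
  proof -
    define p where "p = n - u"
    have p: "1 \<le> p" "p \<le> 2 * w - 2" "i + u = i - p + 1 * n"
      using that n_eq unfolding p_def by linarith+
    show ?thesis
    proof (cases "p \<le> \<mu> \<or> p = w - 1")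
      case True
      with p(1) have "row p = - p" by (rule row_neg)
      then show ?thesis
        by (rule step'[OF Q0 tree_PQ'[of p _ _ _ 1 _ 0, rotated 2]]) (use p size in auto)
    next
      case False
      then have "row (2 * w + p) = - p" using p row_far[of p] by simp
      then show ?thesis
        by (rule step'[OF Q2w tree_PQ'[of "2 * w + p" _ _ _ 1 _ 0, rotated 2]]) (use p size in auto)
    qed
  qed
  have Qw: "(P i, Q (i + w)) \<in> ?R"
    by (rule step[OF P_far[of "3 * w"] tree_PQ'[OF _ _ row_special(5), of _ _ 1 _ 0]])
      (use size in auto)
  have Qw\<mu>: "(P i, Q (i + w + \<mu>)) \<in> ?R"
  proof (rule step[OF _ tree_extra(2)])
    show "(P i, Q (i + w + \<mu> - 1)) \<in> ?R"
    proof (cases "\<mu> = 1")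
      case False
      have *: "i + w + \<mu> - 1 = i + (w + \<mu> - 1)" by simp
      show ?thesis unfolding * by (rule Q_near) (use False size in auto)
    qed (use Qw in simp)
  qed
  have link: "{P (i + 2 * w), Q (i + p)} \<in> tree i" if "1 \<le> p" "p \<le> \<mu>" for p
    by (rule tree_PQ'[of "2 * w + p" "2 * w" _ _ 0 _ "-1"]) (use that size row_far[of p] in auto)
  have link': "{P (i + 2 * w), Q (i + (w - 1))} \<in> tree i"
    by (rule tree_PQ'[OF _ _ row_special(3), of _ _ 0 _ "-1"]) (use size in auto)
  have P2w: "(P i, P (i + 2 * w)) \<in> ?R"
  proof (cases "i < 2 * w")
    case True
    then show ?thesis using tree_extra(3)[of i] by (intro adj_rtrancl_edge) simp
  next
    case False
    have "(P i, Q (i + \<mu> + 2 * w)) \<in> ?R"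
      using Q_star[of "\<mu> + 2 * w"] size by (simp add: add.assoc)
    moreover have "{Q (i + \<mu>), Q (i + \<mu> + 2 * w)} \<in> tree i"
      using False tree_extra(3)[of i] by simp
    ultimately have "(P i, Q (i + \<mu>)) \<in> ?R" by (rule step')
    moreover have "{P (i + 2 * w), Q (i + \<mu>)} \<in> tree i" using \<mu>_ge by (intro link) auto
    ultimately show ?thesis by (rule step')
  qed
  have P2w1: "(P i, P (i + (2 * w + 1))) \<in> ?R"
    using step[OF P2w tree_extra(1)] by (simp add: add.assoc)
  have all_P: "(P i, P (i + u)) \<in> ?R" if u: "0 \<le> u" "u < n" for u
  proof -
    consider "u = 0" | "u = 1" | "2 \<le> u \<and> u < 2 * w" | "u = 2 * w" | "u = 2 * w + 1" | "2 * w + 2 \<le> u"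
      using u by linarith
    then show ?thesis
      using P_star[of u] P1 P2w P2w1 P_far[of u] u by cases simp_all
  qed
  then show "(P i, P (i + u)) \<in> ?R" using u by blast
  \<comment> \<open>This has to wait for \<open>all_P\<close>: the neighbour used can be
    \<open>P (i + (2 * w + 1))\<close>, as for \<open>w = 3\<close> and
    \<open>\<mu> = 1\<close>.\<close>
  have Q_last: "(P i, Q (i + (n - 1))) \<in> ?R"
    by (rule step[OF all_P[of "n - 1 - w - \<mu>"] tree_PQ'[OF _ _ row_special(4), of _ _ 1 _ 1]])
      (use size in auto)
  consider "u = 0 \<or> \<mu> < u \<and> u < 2 * w \<and> u \<noteq> w - 1 \<and> u \<noteq> w \<and> u \<noteq> w + \<mu>"
    | "1 \<le> u \<and> u \<le> \<mu>" | "u = w - 1" | "u = w" | "u = w + \<mu>" | "u = 2 * w"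
    | "2 * w < u \<and> u \<le> n - 2" | "u = n - 1"
    using u by linarith
  then show "(P i, Q (i + u)) \<in> ?R"
  proof cases
    case 1
    then show ?thesis by (rule Q_near)
  next
    case 2
    then show ?thesis using step[OF P2w link[of u]] by simp
  next
    case 3
    then show ?thesis using step[OF P2w link'] by simp
  next
    case 5
    then show ?thesis using Qw\<mu> by (simp add: add.assoc)
  next
    case 7
    then show ?thesis using Q_star by simp
  qed (use Qw Q2w Q_last in simp_all)
qed

text \<open>Injectivity at the identity and the list of all colours are read off from this closed
  form and \<open>xy_0\<close>.\<close>

lemma xx_0:
  assumes "1 \<le> i" "i < n"
  shows "xx 0 i = (if i = 1 then (2, 1) else if i = n - 1 then (2, m - 1)
    else if i = 2 * w then (2, 0) else (0, i))"
proof -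
  have "(n - 1) mod m = (m - 1) mod m"
    by (rule mod_mI[of _ _ 4 "-1"]) (use n_eq in linarith)
  also have "\<dots> = m - 1" by (rule mod_pos_pos_trivial) (use m_ge in auto)
  finally have "(n - 1) mod m = m - 1" .
  moreover have "2 * w mod m = 0" "1 mod m = 1"
    using mod_mI[of "2 * w" 0 2 0] m_ge by simp_all
  moreover have "exceptional (0 - i) \<longleftrightarrow> i = 1 \<or> i = n - 1 \<or> i = 2 * w"
    using assms exceptional_minus[of i] by (simp add: exceptional_small)
  ultimately show ?thesis
    using assms by (auto simp: xx_def)
qed

lemma xy_0:
  assumes "0 \<le> d" "d < n"
  shows "xy 0 d = (if d = 0 \<or> d = n - 1 then (0, d) else if d = w then (0, 1)
    else if d = n - 1 - w then (0, 2 * w)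
    else if 2 * w - \<mu> < d \<and> d < 2 * w + \<mu> - 1 then (2, d - 2 * w + \<mu> + 1) else (1, d))"
proof -
  have "(d + \<mu> + 1) mod m = d - 2 * w + \<mu> + 1" if "2 * w - \<mu> < d" "d < 2 * w + \<mu> - 1"
  proof -
    have "(d + \<mu> + 1) mod m = (d - 2 * w + \<mu> + 1) mod m"
      by (rule mod_mI[of _ _ 2 0]) simp
    also have "\<dots> = d - 2 * w + \<mu> + 1"
      by (rule mod_pos_pos_trivial) (use that m_eq in linarith)+
    finally show ?thesis .
  qed
  moreover have "- (2 * w) mod n = 2 * w" by (rule mod_eqI[of _ _ _ "-1"]) (use size in linarith)+
  ultimately show ?thesis
    using assms xy_shift[OF assms, of 0] by simp
qed

text \<open>Relative to \<open>2 * i\<close>, the half stars give the sums \<open>2\<close> to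
  \<open>2 * w - 1\<close> and \<open>2 * w + 2\<close> to \<open>n - 1\<close>. The differences
  \<open>0\<close>, \<open>n - 1\<close>, \<open>n - 1 - w\<close> and \<open>w\<close> give
  \<open>0\<close>, \<open>1\<close>, \<open>2 * w\<close> and \<open>2 * w + 1\<close>.\<close>

lemma tree_hits_0: "\<exists>j k. {P j, P k} \<in> tree i \<and> xx j k = (0, t) \<or> {Q j, Q k} \<in> tree i \<and> yy j k = (0, t)
    \<or> {P j, Q k} \<in> tree i \<and> xy j k = (0, t)" if t: "0 \<le> t" "t < n"
proof -
  define u where "u = (t - 2 * i) mod n"
  have u: "0 \<le> u" "u < n" using n_pos by (auto simp: u_def)
  have t_eq: "t = (2 * i + u) mod n" using t by (simp add: u_def mod_simps)
  have cell_sum: ?thesis if "d = 0 \<or> d = n - 1" "row d = q" "(2 * (i + q) + d) mod n = t" for d q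
  proof -
    have d: "0 \<le> d" "d < n" using that(1) n_pos by auto
    have "xy (i + row d) (i + row d + d) = (0, t)" using that by (simp only: xy_shift[OF d] if_True)
    with tree_PQ[OF d refl refl] show ?thesis by blast
  qed
  have cell_sum': ?thesis if "d = w \<or> d = n - 1 - w" "row d = q" "(2 * (i + q) + d + 1 - w) mod n = t" for d q
  proof -
    have d: "0 \<le> d" "d < n" and "\<not> (d = 0 \<or> d = n - 1)" using that(1) size by linarith+
    then have "xy (i + row d) (i + row d + d) = (0, t)"
      using that by (simp only: xy_shift[OF d] if_True if_False)
    with tree_PQ[OF d refl refl] show ?thesis by blast
  qed
  consider "2 \<le> u \<and> u < 2 * w" | "2 * w + 2 \<le> u" | "u = 0" | "u = 1" | "u = 2 * w" | "u = 2 * w + 1"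
    using u by linarith
  then show ?thesis
  proof cases
    case 1
    then have "xx i (i + u) = (0, t)"
      using exceptional_minus[of u] size by (simp add: xx_def exceptional_small t_eq)
    with 1 tree_P show ?thesis by blast
  next
    case 2
    define d where "d = n + 1 - u"
    have d: "2 \<le> d" "d < 2 * w" using 2 u n_eq by (auto simp: d_def)
    have "(i + (i - d) + 1) mod n = t"
      unfolding t_eq by (rule mod_add_multipleI[of _ _ "-1"]) (simp add: d_def)
    then have "yy i (i - d) = (0, t)"
      using d size by (simp add: yy_def exceptional_small)
    with d tree_Q show ?thesis by blast
  next
    case 3
    show ?thesis by (rule cell_sum[of 0 0]) (use 3 t_eq row_near[of 0] in auto)
  next
    case 4
    have "(2 * (i + 1) + (n - 1)) mod n = t"
      unfolding t_eq 4 by (rule mod_add_multipleI[of _ _ 1]) simp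
    then show ?thesis by (intro cell_sum[OF _ row_special(1)]) simp_all
  next
    case 5
    have "(2 * (i + 2 * w) + (n - 1 - w) + 1 - w) mod n = t"
      unfolding t_eq 5 by (rule mod_add_multipleI[of _ _ 1]) simp
    then show ?thesis by (intro cell_sum'[OF _ row_special(3)]) simp_all
  next
    case 6
    have "(2 * (i + w) + w + 1 - w) mod n = t"
      unfolding t_eq 6 by (rule mod_add_multipleI[of _ _ 0]) simp
    then show ?thesis by (intro cell_sum'[OF _ row_special(2)]) simp_all
  qed
qed

text \<open>The single edges give the relative values \<open>0\<close>, \<open>1\<close> and
  \<open>2 * \<mu>\<close>, the middle differences all others. The rows of the latter are
  \<open>0\<close>, \<open>- w\<close> or \<open>2 * w\<close>, multiples of \<open>m\<close>, and
  do not affect the colour.\<close>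

lemma tree_hits_2: "\<exists>j k. {P j, P k} \<in> tree i \<and> xx j k = (2, t) \<or> {Q j, Q k} \<in> tree i \<and> yy j k = (2, t)
    \<or> {P j, Q k} \<in> tree i \<and> xy j k = (2, t)" if t: "0 \<le> t" "t < m"
proof -
  define u where "u = (t - 2 * i) mod m"
  have u: "0 \<le> u" "u < m" using pos_mod_bound[of m "t - 2 * i"] pos_mod_sign[of m "t - 2 * i"] m_eq \<mu>_ge
    unfolding u_def by linarith+
  have t_eq: "t = (2 * i + u) mod m" using t by (simp add: u_def mod_simps)
  have cell: ?thesis if d: "2 * w - \<mu> < d" "d < 2 * w + \<mu> - 1"
    and "row d = q" "(2 * (i + q) + d + \<mu> + 1) mod m = t" for d q
  proof -
    have "0 \<le> d" "d < n" "\<not> (d = 0 \<or> d = n - 1)" "\<not> (d = w \<or> d = n - 1 - w)"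
      using d size by linarith+
    then have "xy (i + row d) (i + row d + d) = (2, t)"
      using that by (simp only: xy_shift if_True if_False simp_thms)
    with tree_PQ[OF \<open>0 \<le> d\<close> \<open>d < n\<close> refl refl] show ?thesis by blast
  qed
  have ex: "exceptional (2 * w)" "exceptional 1"
    using size by (auto simp: exceptional_small)
  consider "u = 0" | "u = 1" | "u = 2 * \<mu>" "u \<noteq> 1" | "2 \<le> u" "u \<le> \<mu>" | "u = \<mu> + 1" "u < 2 * \<mu>"
    | "\<mu> + 2 \<le> u" "u < 2 * \<mu>"
    using u m_eq by linarith
  then show ?thesis
  proof cases
    case 1
    have "(i + (i + 2 * w)) mod m = t"
      unfolding t_eq 1 by (rule mod_mI[of _ _ 2 0]) simp
    then have "xx i (i + 2 * w) = (2, t)"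
      using ex(1) exceptional_minus[of "2 * w"] by (simp add: xx_def)
    moreover have "(i + \<mu> + (i + \<mu> + 2 * w) + 1) mod m = t"
      unfolding t_eq 1 by (rule mod_mI[of _ _ 2 1]) (use m_eq in linarith)
    then have "yy (i + \<mu>) (i + \<mu> + 2 * w) = (2, t)"
      using ex(1) exceptional_minus[of "2 * w"] by (simp add: yy_def)
    ultimately show ?thesis using tree_extra(3)[of i] by (cases "i < 2 * w") auto
  next
    case 2
    have "(i + 2 * w + (i + 2 * w + 1)) mod m = t"
      unfolding t_eq 2 by (rule mod_mI[of _ _ 4 0]) simp
    then have "xx (i + 2 * w) (i + 2 * w + 1) = (2, t)"
      using ex(2) exceptional_minus[of 1] by (simp add: xx_def)
    then show ?thesis using tree_extra(1)[of i] by blast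
  next
    case 3
    have "(i + w + \<mu> - 1 + (i + w + \<mu>) + 1) mod m = t"
      unfolding t_eq 3 by (rule mod_mI[of _ _ 2 0]) simp
    then have "yy (i + w + \<mu> - 1) (i + w + \<mu>) = (2, t)"
      using ex(2) exceptional_minus[of 1] by (simp add: yy_def)
    then show ?thesis using tree_extra(2)[of i] by blast
  next
    case 4
    define d where "d = 2 * w - \<mu> - 1 + u"
    have d: "2 * w - \<mu> < d" "d < 2 * w" using 4 by (auto simp: d_def)
    show ?thesis
    proof (rule cell)
      show "row d = 0" using d size by (intro row_near) auto
      show "(2 * (i + 0) + d + \<mu> + 1) mod m = t"
        unfolding t_eq d_def by (rule mod_mI[of _ _ 2 0]) simp
    qed (use d size in linarith)+
  next
    case 5
    show ?thesis
    proof (rule cell[OF _ _ row_special(5)])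
      show "(2 * (i + - w) + 2 * w + \<mu> + 1) mod m = t"
        unfolding t_eq 5 by (rule mod_mI[of _ _ 0 0]) simp
    qed (use 5 size in linarith)+
  next
    case 6
    define d where "d = 2 * w - \<mu> - 1 + u"
    have d: "2 * w < d" "d < 2 * w + \<mu> - 1" using 6 by (auto simp: d_def)
    show ?thesis
    proof (rule cell)
      show "row d = 2 * w" using d size row_far[of "d - 2 * w"] by simp
      show "(2 * (i + 2 * w) + d + \<mu> + 1) mod m = t"
        unfolding t_eq d_def by (rule mod_mI[of _ _ 6 0]) simp
    qed (use d size in linarith)+
  qed
qed

lemma tree_hits:
  assumes \<kappa>: "\<kappa> \<in> xx 0 ` {1..<n} \<union> xy 0 ` {0..<n}"
  shows "\<exists>j k. {P j, P k} \<in> tree i \<and> xx j k = \<kappa> \<or> {Q j, Q k} \<in> tree i \<and> yy j k = \<kappa>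
    \<or> {P j, Q k} \<in> tree i \<and> xy j k = \<kappa>"
proof -
  have "(\<exists>t. 0 \<le> t \<and> t < n \<and> \<kappa> = (0, t)) \<or> (\<exists>t. 0 \<le> t \<and> t < m \<and> \<kappa> = (2, t))
    \<or> (\<exists>d. 0 \<le> d \<and> d < n \<and> \<kappa> = (1, d) \<and> \<kappa> = xy 0 d)"
    using \<kappa>
  proof
    assume "\<kappa> \<in> xx 0 ` {1..<n}"
    then obtain j where j: "1 \<le> j" "j < n" "\<kappa> = xx 0 j" by auto
    then have "\<kappa> = (2, 1) \<or> \<kappa> = (2, m - 1) \<or> \<kappa> = (2, 0) \<or> \<kappa> = (0, j)"
      by (simp add: xx_0)
    then show ?thesis using j(1,2) m_ge by (elim disjE) simp_all
  next
    assume "\<kappa> \<in> xy 0 ` {0..<n}"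
    then obtain d where d: "0 \<le> d" "d < n" "\<kappa> = xy 0 d" by auto
    have "1 < n" "0 \<le> 2 * w" "2 * w < n" using size by linarith+
    moreover have "0 \<le> d - 2 * w + \<mu> + 1 \<and> d - 2 * w + \<mu> + 1 < m"
      if "2 * w - \<mu> < d \<and> d < 2 * w + \<mu> - 1"
      using that m_eq by linarith
    moreover have "\<kappa> = (0, d) \<or> \<kappa> = (0, 1) \<or> \<kappa> = (0, 2 * w)
      \<or> 2 * w - \<mu> < d \<and> d < 2 * w + \<mu> - 1 \<and> \<kappa> = (2, d - 2 * w + \<mu> + 1)
      \<or> \<kappa> = (1, d) \<and> xy 0 d = (1, d)"
      using d by (simp add: xy_0)
    ultimately show ?thesis using d(1,2) by (elim disjE conjE) simp_all
  qed
  then consider t where "0 \<le> t" "t < n" "\<kappa> = (0, t)" | t where "0 \<le> t" "t < m" "\<kappa> = (2, t)"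
    | d where "0 \<le> d" "d < n" "\<kappa> = (1, d)" "\<kappa> = xy 0 d"
    by blast
  then show ?thesis
  proof cases
    case 1
    then show ?thesis using tree_hits_0 by blast
  next
    case 2
    then show ?thesis using tree_hits_2 by blast
  next
    case (3 d)
    then have "xy 0 (0 + d) = (1, d)" by simp
    then have "xy (i + row d) (i + row d + d) = (1, d)"
      unfolding xy_shift[OF 3(1,2)] by (metis prod.inject zero_neq_one numeral_One num.distinct(1) numeral_eq_iff)
    with 3 have "xy (i + row d) (i + row d + d) = \<kappa>" by simp
    then show ?thesis using tree_PQ[OF 3(1,2) refl refl] by blast
  qed
qed

lemma tree_cover: "complete_edges (carrier G) \<subseteq> (\<Union>i\<in>{0..<n}. tree i)"
proof
  fix e assume "e \<in> complete_edges (carrier G)"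
  then show "e \<in> (\<Union>i\<in>{0..<n}. tree i)"
  proof (cases rule: edge_cases)
    case (1 i u)
    consider "u = 1" | "2 \<le> u" "u < 2 * w" | "u = 2 * w" using 1 n_eq by linarith
    then show ?thesis
    proof cases
      case a: 1
      define j where "j = (i - 2 * w) mod n"
      have "P (j + 2 * w) = P i" "P (j + 2 * w + 1) = P (i + 1)"
        using mod_add_left_eq[of "i - 2 * w" n "2 * w + 1"]
        by (auto intro!: P_cong simp: j_def mod_simps add.assoc)
      then have "e \<in> tree j" using tree_extra(1)[of j] 1 a by simp
      then show ?thesis using n_pos by (auto simp: j_def)
    next
      case a: 2
      have "{P (i mod n), P (i + u)} \<in> tree (i mod n)"
        using 1 a by (intro tree_P) (auto simp: mod_simps)
      then show ?thesis using 1 n_pos P_cong[of "i mod n" i] by auto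
    next
      case a: 3
      define j where "j = (if i mod n < 2 * w then i mod n else i mod n - 2 * w)"
      have j: "0 \<le> j" "j < 2 * w" using n_pos n_eq pos_mod_bound[of n i] by (auto simp: j_def)
      have "{P j, P (j + 2 * w)} = e"
      proof (cases "i mod n < 2 * w")
        case True
        then have "P j = P i" "P (j + 2 * w) = P (i + 2 * w)"
          by (auto intro!: P_cong simp: j_def mod_simps)
        then show ?thesis using 1 a by simp
      next
        case False
        have "P j = P (i + 2 * w)" using False
          by (intro P_cong) (simp add: j_def mod_simps, rule mod_add_multipleI[of _ _ "-1"], use n_eq in linarith)
        moreover have "P (j + 2 * w) = P i" using False by (intro P_cong) (simp add: j_def)
        ultimately show ?thesis using 1 a by auto
      qed
      then have "e \<in> tree j" using tree_extra(3)[of j] j by simp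
      then show ?thesis using j n_eq by auto
    qed
  next
    case (2 i u)
    consider "u = 1" | "2 \<le> u" "u < 2 * w" | "u = 2 * w" using 2 n_eq by linarith
    then show ?thesis
    proof cases
      case a: 1
      define j where "j = (i - (w + \<mu> - 1)) mod n"
      have "(j + w + \<mu> - 1) mod n = (i - (w + \<mu> - 1) + (w + \<mu> - 1)) mod n"
        using mod_add_left_eq[of "i - (w + \<mu> - 1)" n "w + \<mu> - 1"] by (simp add: j_def algebra_simps)
      moreover have "(j + w + \<mu>) mod n = (i - (w + \<mu> - 1) + (w + \<mu>)) mod n"
        using mod_add_left_eq[of "i - (w + \<mu> - 1)" n "w + \<mu>"] by (simp add: j_def algebra_simps)
      ultimately have "Q (j + w + \<mu> - 1) = Q i" "Q (j + w + \<mu>) = Q (i + 1)"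
        by (auto intro!: Q_cong)
      then have "e \<in> tree j" using tree_extra(2)[of j] 2 a by simp
      then show ?thesis using n_pos by (auto simp: j_def)
    next
      case a: 2
      have "{Q ((i + u) mod n), Q i} \<in> tree ((i + u) mod n)"
        using a by (intro tree_Q[of u]) (auto simp: mod_simps)
      then show ?thesis using 2 n_pos Q_cong[of "(i + u) mod n" "i + u"] by (auto simp: insert_commute)
    next
      case a: 3
      define k where "k = (i - \<mu>) mod n"
      \<comment> \<open>Of \<open>k\<close> and the index half a turn away, the one not below
        \<open>2 * w\<close>, whose tree has its special edge in the second coset.\<close>
      define j where "j = (if k < 2 * w then k + 2 * w else k)"
      have j: "2 * w \<le> j" "j < n" "0 \<le> j"
        using n_pos n_eq pos_mod_bound[of n "i - \<mu>"] pos_mod_sign[of n "i - \<mu>"]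
        by (auto simp: j_def k_def)
      have k: "(k + c) mod n = (i - \<mu> + c) mod n" for c by (simp add: k_def mod_simps)
      have "{Q (j + \<mu>), Q (j + \<mu> + 2 * w)} = e"
      proof (cases "k < 2 * w")
        case True
        then have "Q (j + \<mu>) = Q (i + 2 * w)" "Q (j + \<mu> + 2 * w) = Q i"
          using k[of "2 * w + \<mu>"] k[of "n + \<mu>"] n_eq
          by (auto intro!: Q_cong simp: j_def algebra_simps)
        then show ?thesis using 2 a by auto
      next
        case False
        then have "Q (j + \<mu>) = Q i" "Q (j + \<mu> + 2 * w) = Q (i + 2 * w)"
          using k[of \<mu>] k[of "\<mu> + 2 * w"]
          by (auto intro!: Q_cong simp: j_def algebra_simps)
        then show ?thesis using 2 a by auto
      qed
      then have "e \<in> tree j" using tree_extra(3)[of j] j by simp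
      then show ?thesis using j by auto
    qed
  next
    case (3 i j)
    define d where "d = (j - i) mod n"
    define k where "k = (i - row d) mod n"
    have d: "0 \<le> d" "d < n" using n_pos by (auto simp: d_def)
    have "{P i, Q j} \<in> tree k"
    proof (rule tree_PQ[OF d])
      show "i mod n = (k + row d) mod n" by (simp add: k_def mod_simps)
      have "(k + row d + d) mod n = ((i - row d) mod n + row d + (j - i) mod n) mod n"
        by (simp add: k_def d_def)
      also have "\<dots> = (i - row d + row d + (j - i)) mod n"
        by (metis mod_add_eq mod_add_left_eq)
      also have "\<dots> = j mod n" by simp
      finally show "j mod n = (k + row d + d) mod n" ..
    qed
    then show ?thesis using 3 n_pos by (auto simp: k_def)
  qed
qed

theorem factorization:
  "\<exists>F S. one_factorization (carrier G) F \<and> G_regular G F \<and> complete_rainbow_set (carrier G) F S"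
proof -
  \<comment> \<open>\<open>b\<close> moves every position by one step and raises half the sum by 1,
    while \<open>a\<close>, its square, raises it by 2. Only \<open>b\<close> exchanges the cosets
    and reverses differences.\<close>
  define shift :: "int \<Rightarrow> nat \<times> int \<Rightarrow> nat \<times> int"
    where "shift c = (\<lambda>(k, t). if k = 0 then (0, (t + c) mod n) else if k = 2 then (2, (t + c) mod m)
      else (1, if c = 1 then n - 1 - t else t))" for c
  have period: "(i mod n + j mod n + c) mod n = (i + j + c) mod n"
    "(i mod n + j mod n + c) mod m = (i + j + c) mod m" for i j c
  proof -
    show "(i mod n + j mod n + c) mod n = (i + j + c) mod n"
      by (metis mod_add_eq mod_add_left_eq)
    then show "(i mod n + j mod n + c) mod m = (i + j + c) mod m"
      by (metis mod_n_mod_m)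
  qed
  have exc: "exceptional (i mod n - j mod n) \<longleftrightarrow> exceptional (i - j)" for i j
    by (simp add: exceptional_def mod_simps)
  show ?thesis
  proof (rule factorization_from_indices[of xx yy xy "shift 2" "shift 1" tree])
    show "xx i j = xx j i" "yy i j = yy j i" for i j
      using exceptional_minus[of "i - j"] by (auto simp: xx_def yy_def add.commute)
    show "xx (i mod n) (j mod n) = xx i j" "yy (i mod n) (j mod n) = yy i j" for i j
      using period[of i j 0] period[of i j 1] by (simp_all add: xx_def yy_def exc)
    show "xy (i mod n) (j mod n) = xy i j" for i j
    proof -
      have "(i mod n + j mod n + 1 - w) mod n = (i + j + 1 - w) mod n"
        using period(1)[of i j "1 - w"] by (simp only: add_diff_eq)
      moreover have "(i mod n + j mod n + \<mu> + 1) mod m = (i + j + \<mu> + 1) mod m"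
        using period(2)[of i j "\<mu> + 1"] by (simp only: add.assoc)
      ultimately show ?thesis by (simp only: xy_def mod_diff_eq mod_add_eq)
    qed
    show "i = j" if "i \<in> {1..<n}" "j \<in> {1..<n}" "xx 0 i = xx 0 j" for i j
      using that m_ge by (auto simp: xx_0 split: if_splits)
    have bounds: "1 < 2 * w" "2 * w < n - 1" "2 * \<mu> \<le> m - 1" using size m_eq by linarith+
    show "i = j" if "i \<in> {0..<n}" "j \<in> {0..<n}" "xy 0 i = xy 0 j" for i j
      using that bounds by (auto simp: xy_0 split: if_splits)
    show "xx 0 i \<noteq> xy 0 j" if "i \<in> {1..<n}" "j \<in> {0..<n}" for i j
      using that bounds by (auto simp: xx_0 xy_0)
    show "xx (i + 1) (j + 1) = shift 2 (xx i j)" "yy (i + 1) (j + 1) = shift 2 (yy i j)" for i j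
      by (auto simp: xx_def yy_def shift_def mod_simps algebra_simps)
    show "xy (i + 1) (j + 1) = shift 2 (xy i j)" for i j
      by (auto simp: xy_def shift_def Let_def mod_simps algebra_simps)
    show "yy (1 * i) (1 * j) = shift 1 (xx i j)" "xx (1 * i + 1) (1 * j + 1) = shift 1 (yy i j)" for i j
      by (auto simp: xx_def yy_def shift_def mod_simps algebra_simps)
    show "xy (1 * j + 1) (1 * i) = shift 1 (xy i j)" for i j
    proof -
      define d where "d = (j - i) mod n"
      have d: "0 \<le> d" "d < n" using n_pos by (auto simp: d_def)
      have "(i - (j + 1)) mod n = n - 1 - d"
      proof -
        have "(i - (j + 1)) mod n = (- 1 - (j - i)) mod n" by (simp add: algebra_simps)
        also have "\<dots> = (- 1 - d) mod n" by (simp add: d_def mod_simps)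
        also have "\<dots> = n - 1 - d" by (rule mod_eqI[of _ _ _ "-1"]) (use d in auto)
        finally show ?thesis .
      qed
      then show ?thesis
        using d size unfolding xy_def shift_def
        by (auto simp: Let_def mod_simps algebra_simps simp flip: d_def)
    qed
  qed (use tree_edges tree_card tree_connected tree_hits tree_cover in auto)
qed

end

section \<open>Normal forms of the groups\<close>

lemma odd_part:
  fixes n :: nat
  assumes "n > 0"
  obtains k m where "n = 2 ^ k * m" "odd m"
  using assms
proof (induction n arbitrary: thesis rule: less_induct)
  case (less n)
  show ?case
  proof (cases "even n")
    case True
    then obtain j where j: "n = 2 * j" ..
    with less.prems(2) obtain k m where "j = 2 ^ k * m" "odd m"
      using less.IH[of j] by auto
    with j less.prems(1)[of "Suc k" m] show ?thesis by simp
  next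
    case False
    with less.prems(1)[of 0 n] show ?thesis by simp
  qed
qed

section \<open>Relations between \<open>r\<close> and \<open>g\<close>, and the choice of
  \<open>b\<close>\<close>

context cyclic_index_two
begin

text \<open>The square of \<open>b\<close> is a power of \<open>a\<close>, so conjugating
  \<open>a\<close> twice by \<open>b\<close> has no effect.\<close>

lemma r_r_mod: "r * r mod n = 1 mod n"
proof -
  have "P (r * r + g) = P 1 \<otimes> b \<otimes> b"
    by (simp add: P_mult_b Q_mult_b)
  also have "\<dots> = P 1 \<otimes> P g" by (simp add: m_assoc b_b P_def)
  also have "\<dots> = P (1 + g)" by (simp add: P_def int_pow_mult)
  finally have "(r * r + g - g) mod n = (1 + g - g) mod n"
    unfolding P_eq_iff by (metis mod_diff_left_eq)
  then show ?thesis by simp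
qed

text \<open>This expresses that \<open>b\<close> commutes with its own square.\<close>

lemma r_g_mod: "r * g mod n = g mod n"
proof -
  have "Q (r * g) = b \<otimes> b \<otimes> b" by (simp add: b_b flip: P_def P_mult_b)
  also have "\<dots> = b \<otimes> (b \<otimes> b)" by (simp only: m_assoc b_closed)
  also have "\<dots> = Q g" by (simp add: b_b Q_def)
  finally show ?thesis by (simp add: Q_eq_iff)
qed

lemma b_eq: "b = Q i \<otimes> a [^] (- i)"
  by (simp add: Q_def m_assoc flip: int_pow_mult)

lemma Q_mult_Q: "Q i \<otimes> Q i = P (g + (r + 1) * i)"
proof -
  have "Q i \<otimes> Q i = Q i \<otimes> b \<otimes> P i" by (simp add: Q_def P_def m_assoc)
  also have "\<dots> = P (r * i + g + i)" by (simp add: Q_mult_b) (simp add: P_def int_pow_mult)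
  finally show ?thesis by (simp add: algebra_simps)
qed

text \<open>Replacing \<open>b\<close> by \<open>b \<otimes> a [^] i\<close> keeps the conjugation
  and adds \<open>(r + 1) * i\<close> to the exponent of the square, which leaves \<open>i\<close>
  free for normalising \<open>g\<close>.\<close>

lemma change_b:
  assumes "(g + (r + 1) * i) mod n = g' mod n" "r mod n = r' mod n"
  shows "cyclic_index_two G a (Q i) n r' g'"
proof
  show "carrier G = generate G {a, Q i}"
  proof
    have sub: "subgroup (generate G {a, Q i}) G" by (rule generate_is_subgroup) simp
    have in_gen: "a \<in> generate G {a, Q i}" "Q i \<in> generate G {a, Q i}" by (auto intro: generate.incl)
    then have "b \<in> generate G {a, Q i}"
      using sub b_eq[of i] by (metis subgroup.m_closed subgroup_int_pow_closed)
    with in_gen have "generate G {a, b} \<subseteq> generate G {a, Q i}"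
      by (intro generate_subgroup_incl[OF _ sub]) simp
    then show "carrier G \<subseteq> generate G {a, Q i}" by (simp only: generated)
    show "generate G {a, Q i} \<subseteq> carrier G" by (rule generate_incl) simp
  qed
  show "a \<otimes> Q i = Q i \<otimes> a [^] r'"
  proof -
    have "a \<otimes> Q i = a \<otimes> b \<otimes> P i" by (simp add: Q_def P_def m_assoc)
    also have "\<dots> = Q (r + i)" by (simp add: a_b Q_def P_def m_assoc int_pow_mult)
    also have "\<dots> = Q (i + r')" by (rule Q_cong) (metis assms(2) add.commute mod_add_right_eq)
    finally show ?thesis by (simp add: Q_def m_assoc int_pow_mult)
  qed
  show "Q i \<otimes> Q i = a [^] g'"
    unfolding Q_mult_Q using P_cong[OF assms(1)] by (simp add: P_def)
qed (use finite_carrier n_pos order_G a_pow_n in auto)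

lemma factorization_if_square_central:
  assumes n: "n = 2 * s" "s \<ge> 2" and i: "s dvd g + (r + 1) * i"
  shows "\<exists>F S. one_factorization (carrier G) F \<and> G_regular G F \<and> complete_rainbow_set (carrier G) F S"
proof -
  define h where "h = (g + (r + 1) * i) mod n"
  interpret s: cyclic_index_two G a "Q i" n r h
    by (rule change_b) (simp_all add: h_def)
  have "s dvd h" using i n by (simp add: h_def dvd_mod_iff)
  then obtain k where k: "h = s * k" ..
  have "0 \<le> h" "h < n" using n_pos by (simp_all add: h_def)
  with n k have "0 \<le> k" "k < 2" by (simp_all add: zero_le_mult_iff)
  then have "k = 0 \<or> k = 1" by linarith
  with k have "h = 0 \<or> h = s" by auto
  moreover have "r * r mod n = 1" using r_r_mod n by simp
  ultimately interpret s: square_central G a "Q i" n r h s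
    using n by unfold_locales auto
  show ?thesis by (rule s.factorization)
qed

lemma factorization_if_square_generator:
  assumes "r mod n = 1 mod n" "odd g" and m: "odd m" "m \<ge> 3" "4 * m dvd n"
  shows "\<exists>F S. one_factorization (carrier G) F \<and> G_regular G F \<and> complete_rainbow_set (carrier G) F S"
proof -
  obtain k where k: "g = 2 * k + 1" using \<open>odd g\<close> by (elim oddE)
  have "(g + (r + 1) * (- k)) mod n = (1 + (1 - r) * k) mod n" by (simp add: k algebra_simps)
  also have "n dvd (1 - r)" using assms(1) by (metis mod_eq_dvd_iff)
  then have "(1 + (1 - r) * k) mod n = 1 mod n" by (simp add: mod_eq_dvd_iff)
  finally interpret s: cyclic_index_two G a "Q (- k)" n 1 1
    using assms(1) by (intro change_b) auto
  interpret s: square_generator G a "Q (- k)" n m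
    using m by unfold_locales
  show ?thesis by (rule s.factorization)
qed

text \<open>A suitable \<open>Q i\<close> has square \<open>a\<close>.\<close>

lemma cyclic_if_odd:
  assumes "r mod n = 1 mod n" "odd g"
  shows "cyclic_grp G"
proof -
  obtain k where k: "g = 2 * k + 1" using \<open>odd g\<close> by (elim oddE)
  let ?c = "Q (- k)"
  have "Q (- k) \<otimes> Q (- k) = P (1 + (1 - r) * k)" by (simp add: Q_mult_Q k algebra_simps)
  also have "n dvd (1 - r)" using assms(1) by (metis mod_eq_dvd_iff)
  then have "P (1 + (1 - r) * k) = P 1" by (intro P_cong) (simp add: mod_eq_dvd_iff)
  finally have a: "a = ?c \<otimes> ?c" by (simp add: P_def)
  have sub: "subgroup (generate G {?c}) G" by (rule generate_is_subgroup) simp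
  have c: "?c \<in> generate G {?c}" by (auto intro: generate.incl)
  have "a \<in> generate G {?c}" using sub c by (subst a) (rule subgroup.m_closed)
  moreover from this have "b \<in> generate G {?c}"
    using sub c b_eq[of "- k"] by (metis subgroup.m_closed subgroup_int_pow_closed)
  ultimately have "generate G {a, b} \<subseteq> generate G {?c}"
    by (intro generate_subgroup_incl[OF _ sub]) simp
  then have "carrier G \<subseteq> generate G {?c}" by (simp only: generated)
  moreover have "generate G {?c} \<subseteq> carrier G" by (rule generate_incl) simp
  ultimately have "carrier G = generate G {?c}" by (rule equalityI)
  then show ?thesis unfolding cyclic_grp_def by (rule bexI[OF _ Q_closed])
qed

lemma comm_group_r:
  assumes "comm_group G"
  shows "r mod n = 1 mod n"
proof -
  have "Q r = a \<otimes> b" by (simp add: a_b Q_def)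
  also have "\<dots> = Q 1" using comm_groupE(4)[OF assms, of a b] by (simp add: Q_def)
  finally show ?thesis by (simp add: Q_eq_iff)
qed

text \<open>Here \<open>r\<close> is 1 modulo \<open>n\<close>, so \<open>g\<close> may be changed
  by even numbers and reaches \<open>0\<close> or \<open>s\<close> unless \<open>g\<close> is odd
  and \<open>s\<close> is even. In that case the group is cyclic, hence no 2-group, and the odd part
  of \<open>n\<close> serves as \<open>m\<close>.\<close>

lemma factorization_comm:
  assumes n: "n = 2 * s" "s \<ge> 2" and comm: "comm_group G" and not: "\<not> (cyclic_grp G \<and> two_group G)"
  shows "\<exists>F S. one_factorization (carrier G) F \<and> G_regular G F \<and> complete_rainbow_set (carrier G) F S"
proof -
  have r: "r mod n = 1 mod n" by (rule comm_group_r[OF comm])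
  then have "n dvd r - 1" by (simp add: mod_eq_dvd_iff)
  then have sr: "s dvd (r - 1) * i" for i using n by (meson dvd_mult2 dvd_trans dvd_triv_right)
  have split: "g + (r + 1) * i = (g + 2 * i) + (r - 1) * i" for i by (simp add: algebra_simps)
  show ?thesis
  proof (cases "even g \<or> odd s")
    case True
    then obtain i where "g + 2 * i = 0 \<or> g + 2 * i = s"
    proof
      assume "even g"
      then show ?thesis using that[of "- (g div 2)"] by simp
    next
      assume "odd s"
      show ?thesis
      proof (cases "even g")
        case True
        then show ?thesis using that[of "- (g div 2)"] by simp
      next
        case False
        with \<open>odd s\<close> have "even (s - g)" by simp
        then show ?thesis using that[of "(s - g) div 2"] by simp
      qed
    qed
    then have "s dvd g + 2 * i" by auto
    then have "s dvd g + (r + 1) * i" unfolding split using sr by (rule dvd_add)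
    with n show ?thesis by (rule factorization_if_square_central)
  next
    case False
    with r have "cyclic_grp G" by (intro cyclic_if_odd) auto
    with not have "\<not> two_group G" by blast
    have "nat n > 0" using n_pos by simp
    then obtain k m where km: "nat n = 2 ^ k * m" "odd m" by (rule odd_part)
    have "m \<noteq> 1"
    proof
      assume "m = 1"
      with km have "order G = 2 ^ Suc k" using order_G by simp
      with \<open>\<not> two_group G\<close> finite_carrier show False unfolding two_group_def by blast
    qed
    with km have "m \<ge> 3" by (cases "m = 0"; cases "m = 2") auto
    obtain t where t: "s = 2 * t" using False by blast
    have n4: "n = 4 * t" using n t by simp
    have "4 dvd 2 ^ k * m"
    proof -
      have "int (2 ^ k * m) = 4 * t" unfolding km(1)[symmetric] using n4 n_pos by simp
      then have "int 4 dvd int (2 ^ k * m)" by simp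
      then show ?thesis by (simp only: int_dvd_int_iff)
    qed
    then have "4 dvd (2::nat) ^ k"
    proof -
      have "coprime ((2::nat) ^ 2) m" using \<open>odd m\<close> by (simp only: coprime_power_left_iff coprime_left_2_iff_odd) simp
      then have "coprime 4 m" by simp
      with \<open>4 dvd 2 ^ k * m\<close> show ?thesis by (simp add: coprime_dvd_mult_left_iff)
    qed
    then have "4 * m dvd nat n" unfolding km(1) by (rule mult_dvd_mono) simp
    then have "int (4 * m) dvd n" using n_pos by (simp add: int_dvd_int_iff[symmetric] del: int_dvd_int_iff)
    then show ?thesis
      using r False \<open>m \<ge> 3\<close> \<open>odd m\<close> by (intro factorization_if_square_generator[of "int m"]) auto
  qed
qed

text \<open>Since \<open>r^2 = 1\<close> modulo a power of 2, one of \<open>r - 1\<close> and \<open>r + 1\<close> is twice an odd number. This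
  replaces the classification of the 2-groups with a cyclic subgroup of index 2.\<close>

lemma factorization_two_group:
  assumes n: "n = 2 * s" "s \<ge> 2" and two: "two_group G" and not: "\<not> cyclic_grp G"
  shows "\<exists>F S. one_factorization (carrier G) F \<and> G_regular G F \<and> complete_rainbow_set (carrier G) F S"
proof -
  obtain K where "order G = 2 ^ K" using two by (auto simp: two_group_def)
  then have "2 * nat n = 2 ^ K" using order_G by simp
  then have "nat n = 2 ^ (K - 1)" using n_pos by (cases K) auto
  then have "n = 2 ^ (K - 1)" using n_pos by (metis int_nat_eq less_imp_le of_nat_numeral of_nat_power)
  then have cop_n: "coprime n x" if "odd x" for x using that by simp
  have cop_s: "coprime s x" if "odd x" for x
    using cop_n[OF that] n by simp
  have n_rg: "n dvd (r - 1) * g"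
    using r_g_mod by (simp add: mod_eq_dvd_iff algebra_simps)
  have "n dvd r * r - 1" using r_r_mod by (simp add: mod_eq_dvd_iff)
  then have "even (r * r - 1)" using n by (meson dvd_trans dvd_triv_left)
  then have odd_r: "odd r" by simp
  have "\<exists>i. s dvd g + (r + 1) * i"
  proof (cases "4 dvd r - 1")
    \<comment> \<open>Now \<open>r - 1\<close> is twice a unit modulo \<open>s\<close>, so
      \<open>r_g_mod\<close> already forces \<open>s\<close> to divide \<open>g\<close>.\<close>
    case False
    obtain u where u: "r - 1 = 2 * u" using odd_r by (auto elim: oddE)
    with False have "odd u" by auto
    have "s dvd u * g" using n_rg by (simp add: n u)
    then have "s dvd g" using cop_s[OF \<open>odd u\<close>] by (simp add: coprime_dvd_mult_right_iff)
    then show ?thesis by (intro exI[of _ 0]) simp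
  next
    case True
    then obtain v where "r - 1 = 4 * v" ..
    then have r: "r + 1 = 2 * (2 * v + 1)" by simp
    have "even g"
    proof (rule ccontr)
      assume "odd g"
      then have "n dvd r - 1" using n_rg cop_n by (simp add: coprime_dvd_mult_left_iff)
      then have "r mod n = 1 mod n" by (simp add: mod_eq_dvd_iff)
      with \<open>odd g\<close> not cyclic_if_odd show False by blast
    qed
    then obtain g' where g': "g = 2 * g'" ..
    have "gcd s (2 * v + 1) = 1" using cop_s[of "2 * v + 1"] by simp
    \<comment> \<open>\<open>y\<close> inverts \<open>2 * v + 1\<close> modulo \<open>s\<close>, so
      \<open>i = - g' * y\<close> makes the exponent of the square a multiple of
      \<open>s\<close>.\<close>
    then obtain x y where xy: "x * s + y * (2 * v + 1) = 1"
      using bezout_int[of s "2 * v + 1"] by auto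
    have "g + (r + 1) * (- g' * y) = 2 * g' * (1 - y * (2 * v + 1))"
      by (simp only: g' r) (simp add: algebra_simps)
    also have "1 - y * (2 * v + 1) = x * s" using xy by linarith
    also have "2 * g' * (x * s) = s * (2 * g' * x)" by simp
    finally show ?thesis by (metis dvd_triv_left)
  qed
  then show ?thesis using factorization_if_square_central[OF n] by blast
qed

end

text \<open>Any \<open>b\<close> outside the subgroup works: by counting, \<open>H\<close> and its
  coset by \<open>b\<close> fill the group, and cancellation places \<open>b \<otimes> b\<close> in
  \<open>H\<close> and \<open>a \<otimes> b\<close> in the coset.\<close>

lemma cyclic_index_two_if_has_cyclic_subgroup_index2:
  fixes G (structure)
  assumes "group G" "finite (carrier G)" "has_cyclic_subgroup_index2 G" "order G = 2 * n" "n > 0"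
  obtains a b r g where "cyclic_index_two G a b (int n) r g"
proof -
  interpret group G by fact
  obtain H a where H: "subgroup H G" "a \<in> H" "H = generate G {a}" "2 * card H = order G"
    using assms(3) by (auto simp: has_cyclic_subgroup_index2_def cyclic_subgroup_def)
  interpret H: subgroup H G by fact
  have cardH: "card H = n" using H(4) assms(4) by simp
  have a: "a \<in> carrier G" using H(2) by simp
  have finH: "finite H" using assms(2) H.subset finite_subset by blast
  have "H \<noteq> carrier G" using cardH assms(4,5) by (auto simp: order_def)
  then obtain b where b: "b \<in> carrier G" "b \<notin> H" using H.subset by blast
  have disj: "H \<inter> (\<lambda>h. b \<otimes> h) ` H = {}"
  proof -
    have False if "h \<in> H" "b \<otimes> h \<in> H" for h
    proof -
      have "b = b \<otimes> h \<otimes> inv h" using that b by (simp add: m_assoc)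
      then show False using that b H.m_closed H.m_inv_closed by metis
    qed
    then show ?thesis by auto
  qed
  have "card (H \<union> (\<lambda>h. b \<otimes> h) ` H) = 2 * n"
    using disj finH cardH b by (simp add: card_Un_disjoint card_image inj_on_def)
  then have carrier: "H \<union> (\<lambda>h. b \<otimes> h) ` H = carrier G"
    using assms(2,4) b by (intro card_subset_eq) (auto simp: order_def)
  have coset: "\<exists>h\<in>H. x = b \<otimes> h" if "x \<in> carrier G" "x \<notin> H" for x
    using that carrier by auto
  have pow: "\<exists>k::int. h = a [^] k" if "h \<in> H" for h
    using that H(3) generate_pow[OF a] by auto
  have "b \<otimes> b \<in> H"
  proof (rule ccontr)
    assume "b \<otimes> b \<notin> H"
    then obtain h where "h \<in> H" "b \<otimes> b = b \<otimes> h" using coset[of "b \<otimes> b"] b by auto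
    with b show False by simp
  qed
  then obtain g where g: "b \<otimes> b = a [^] (g::int)" using pow by blast
  have "a \<otimes> b \<notin> H"
  proof
    assume "a \<otimes> b \<in> H"
    then have "inv a \<otimes> (a \<otimes> b) \<in> H" by (rule H.m_closed[OF H.m_inv_closed[OF H(2)]])
    moreover have "inv a \<otimes> (a \<otimes> b) = b" using a b by (metis inv_closed l_inv l_one m_assoc)
    ultimately show False using b by simp
  qed
  then obtain h where "h \<in> H" "a \<otimes> b = b \<otimes> h" using coset[of "a \<otimes> b"] a b by auto
  with pow obtain r where r: "a \<otimes> b = b \<otimes> a [^] (r::int)" by blast
  have "a [^] n = \<one>"
    using generate_pow_card[OF a] pow_ord_eq_1[OF a] cardH H(3) by simp
  then have a_n: "a [^] int n = \<one>" by (simp add: int_pow_int)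
  have sub: "subgroup (generate G {a, b}) G" using a b by (intro generate_is_subgroup) simp
  have b_in: "b \<in> generate G {a, b}" by (auto intro: generate.incl)
  have H_in: "H \<subseteq> generate G {a, b}" unfolding H(3) by (rule mono_generate) simp
  have "carrier G \<subseteq> generate G {a, b}"
    unfolding carrier[symmetric] using H_in b_in subgroup.m_closed[OF sub] by auto
  moreover have "generate G {a, b} \<subseteq> carrier G" using a b by (intro generate_incl) simp
  ultimately have "cyclic_index_two G a b (int n) r g"
    using a b g r a_n assms by unfold_locales auto
  then show thesis by (rule that)
qed

text \<open>Dihedral and dicyclic groups come with \<open>r = -1\<close>, where the square of every
  \<open>Q i\<close> equals that of \<open>b\<close>, already \<open>1\<close> or
  \<open>a [^] s\<close>. The other two classes obtain \<open>a\<close> and \<open>b\<close> from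
  the cyclic subgroup.\<close>

theorem theorem1p1:
  fixes G :: "('a, 'b) monoid_scheme" and n :: nat
  assumes "group G" and "finite (carrier G)"
    and "n > 2" and "even n" and "order G = 2 * n"
    and "dihedral_grp G
         \<or> dicyclic_grp G
         \<or> (comm_group G \<and> has_cyclic_subgroup_index2 G \<and> \<not> (cyclic_grp G \<and> two_group G))
         \<or> (two_group G \<and> \<not> cyclic_grp G \<and> has_cyclic_subgroup_index2 G)"
  shows "\<exists>F S. one_factorization (carrier G) F \<and> G_regular G F
               \<and> complete_rainbow_set (carrier G) F S"
proof -
  interpret group G by fact
  obtain s where s: "int n = 2 * int s" "int s \<ge> 2" "n = 2 * s"
    using assms(3,4) by (auto elim!: evenE)
  have n_pos: "n > 0" using assms(3) by simp
  have conj: "a \<otimes>\<^bsub>G\<^esub> b = b \<otimes>\<^bsub>G\<^esub> a [^]\<^bsub>G\<^esub> (- 1 :: int)"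
    if "a \<in> carrier G" "b \<in> carrier G" "inv\<^bsub>G\<^esub> b \<otimes>\<^bsub>G\<^esub> a \<otimes>\<^bsub>G\<^esub> b = inv\<^bsub>G\<^esub> a" for a b
  proof -
    have "a \<otimes>\<^bsub>G\<^esub> b = b \<otimes>\<^bsub>G\<^esub> (inv\<^bsub>G\<^esub> b \<otimes>\<^bsub>G\<^esub> a \<otimes>\<^bsub>G\<^esub> b)"
      using that(1,2) by (metis inv_closed l_one m_assoc m_closed r_inv)
    also have "\<dots> = b \<otimes>\<^bsub>G\<^esub> a [^]\<^bsub>G\<^esub> (- 1 :: int)"
      unfolding that(3) using that(1) by (simp add: int_pow_neg int_pow_1)
    finally show ?thesis .
  qed
  have sq: "b [^]\<^bsub>G\<^esub> (2::nat) = b \<otimes>\<^bsub>G\<^esub> b" if "b \<in> carrier G" for b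
    using that by (simp add: numeral_2_eq_2)
  from assms(6) show ?thesis
  proof (elim disjE conjE)
    assume "dihedral_grp G"
    then obtain a b where ab: "a \<in> carrier G" "b \<in> carrier G" "carrier G = generate G {a, b}"
      "a [^]\<^bsub>G\<^esub> (order G div 2) = \<one>\<^bsub>G\<^esub>" "b [^]\<^bsub>G\<^esub> (2::nat) = \<one>\<^bsub>G\<^esub>"
      "inv\<^bsub>G\<^esub> b \<otimes>\<^bsub>G\<^esub> a \<otimes>\<^bsub>G\<^esub> b = inv\<^bsub>G\<^esub> a"
      by (auto simp: dihedral_grp_def)
    then interpret D: cyclic_index_two G a b "int n" "-1" 0
      using assms conj[OF ab(1,2,6)] sq[OF ab(2)] by unfold_locales (auto simp: int_pow_int)
    show ?thesis by (rule D.factorization_if_square_central[OF s(1,2), of 0]) simp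
  next
    assume "dicyclic_grp G"
    then obtain t a b where t: "order G = 4 * t"
      and ab: "a \<in> carrier G" "b \<in> carrier G" "carrier G = generate G {a, b}"
      "a [^]\<^bsub>G\<^esub> (2 * t) = \<one>\<^bsub>G\<^esub>" "b [^]\<^bsub>G\<^esub> (2::nat) = a [^]\<^bsub>G\<^esub> t"
      "inv\<^bsub>G\<^esub> b \<otimes>\<^bsub>G\<^esub> a \<otimes>\<^bsub>G\<^esub> b = inv\<^bsub>G\<^esub> a"
      by (auto simp: dicyclic_grp_def)
    have "t = s" using t s(3) assms(5) by simp
    have "a [^]\<^bsub>G\<^esub> int n = \<one>\<^bsub>G\<^esub>" "b \<otimes>\<^bsub>G\<^esub> b = a [^]\<^bsub>G\<^esub> int s"
      using ab(4,5) sq[OF ab(2)] unfolding \<open>t = s\<close> s(3) int_pow_int by simp_all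
    then interpret D: cyclic_index_two G a b "int n" "-1" "int s"
      using assms conj[OF ab(1,2,6)] ab(1-3) by unfold_locales auto
    show ?thesis by (rule D.factorization_if_square_central[OF s(1,2), of 0]) simp
  next
    assume comm: "comm_group G" and ind: "has_cyclic_subgroup_index2 G"
      and not: "\<not> (cyclic_grp G \<and> two_group G)"
    obtain a b r g where "cyclic_index_two G a b (int n) r g"
      by (rule cyclic_index_two_if_has_cyclic_subgroup_index2[OF assms(1,2) ind assms(5) n_pos])
    then show ?thesis by (rule cyclic_index_two.factorization_comm[OF _ s(1,2) comm not])
  next
    assume two: "two_group G" and not: "\<not> cyclic_grp G" and ind: "has_cyclic_subgroup_index2 G"
    obtain a b r g where "cyclic_index_two G a b (int n) r g"
      by (rule cyclic_index_two_if_has_cyclic_subgroup_index2[OF assms(1,2) ind assms(5) n_pos])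
    then show ?thesis by (rule cyclic_index_two.factorization_two_group[OF _ s(1,2) two not])
  qed
qed

end
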